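(* Let $(\mathfrak{g},\langle\cdot,\cdot\rangle)$ be a non-commutative flat Lie algebra with adapted basis $s_1,\ldots,s_{k_0},z_1,\ldots,z_{\ell_0},d_1,\ldots,d_{2m}$ and structure constants $\lambda_{ki}$ (as defined in the context). Let $r\in\wedge^2\mathfrak{g}$ and suppose that $\mathfrak{g}$, endowed with the $1$-coboundary $\xi(x)=\mathrm{ad}_xr$, is metaflat. (1) If $\mathfrak{g}$ is nondegenerate, then there are real coefficients such that $$r=\sum_{1\leq i<j\leq k_0}a_{ij}\,s_i\wedge s_j+\sum_{\substack{1\leq i\leq k_0\\ 1\leq j\leq\ell_0}}b_{ij}\,s_i\wedge z_j+\sum_{1\leq i<j\leq\ell_0}f_{ij}\,z_i\wedge z_j+\sum_{1\leq i\leq m}n_{ii}\,d_{2i-1}\wedge d_{2i}.$$ (2) If $\mathfrak{g}$ is degenerate, then there are real coefficients such that $$r=\sum_{1\leq i<j\leq k_0}a_{ij}\,s_i\wedge s_j+\sum_{\substack{1\leq i\leq k_0\\ 1\leq j\leq\ell_0}}b_{ij}\,s_i\wedge z_j+\sum_{1\leq i<j\leq\ell_0}f_{ij}\,z_i\wedge z_j$$ $$\qquad+\sum_{1\leq i<j\leq m}m_{ij}\,d_{2i-1}\wedge d_{2j-1}+\sum_{1\leq i,j\leq m}n_{ij}\,d_{2i-1}\wedge d_{2j}+\sum_{1\leq i<j\leq m}p_{ij}\,d_{2i}\wedge d_{2j},$$ where for all $1\leq i<j\leq m$ one has $p_{ij}=\varepsilon_{ij}m_{ij}$ and $n_{ji}=\varepsilon_{ij}n_{ij}$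 with $\varepsilon_{ij}\in\{-1,1\}$; here, whenever there is a sign $\varepsilon\in\{-1,1\}$ with $\lambda_{kj}=\varepsilon\lambda_{ki}$ for all $k=1,\ldots,k_0$, $\varepsilon_{ij}$ is that sign.
   Context: All Lie algebras are real and finite-dimensional. Flat Lie algebra: a Lie algebra $\mathfrak{g}$ with a positive definite scalar product $\langle\cdot,\cdot\rangle$ such that the infinitesimal Levi-Civita connection defined by $2\langle\nabla_xy,z\rangle=\langle[x,y],z\rangle+\langle[z,x],y\rangle+\langle[z,y],x\rangle$ has zero curvature: $\nabla_{[x,y]}z-(\nabla_x\nabla_yz-\nabla_y\nabla_xz)=0$ for all $x,y,z\in\mathfrak{g}$. Known structure: a flat Lie algebra decomposes orthogonally as $\mathfrak{g}=\mathfrak{s}\oplus\mathfrak{z}\oplus\mathfrak{d}$, where $\mathfrak{z}$ is the center, $\mathfrak{d}=[\mathfrak{g},\mathfrak{g}]$ is the commutator ideal (abelian, of even dimension $2m$), and $\mathfrak{s}$, the orthogonal complement of $\mathfrak{z}\oplus\mathfrak{d}$, is an abelian subalgebra. Adapted basis: $s_1,\ldots,s_{k_0}$ is a basis of $\mathfrak{s}$, $z_1,\ldots,z_{\ell_0}$ a basis of $\mathfrak{z}$ (possibly trivial), and $d_1,\ldots,d_{2m}$ an orthonormal basis of $\mathfrak{d}$ such that, for real numbers $\lambda_{ij}$, $[s_i,d_{2j-1}]=\lambda_{ij}d_{2j}$ and $[s_i,d_{2j}]=-\lambda_{ij}d_{2j-1}$ for all $1\le i\le k_0$, $1\le j\le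 m$. Such a basis exists, one has $k_0\leq m$, and the basis of $\mathfrak{s}$ may be chosen arbitrarily: $\lambda_{kj}=\lambda_j(s_k)$ for linear forms $\lambda_1,\ldots,\lambda_m$ on $\mathfrak{s}$. Nondegenerate: $\mathfrak{g}$ is nondegenerate if there exists a basis $\{s_1,\ldots,s_{k_0}\}$ of $\mathfrak{s}$ such that for all $i,j\in\{1,\ldots,m\}$ with $i\neq j$ there exists $k\in\{1,\ldots,k_0\}$ with $\lambda_{kj}^2\neq\lambda_{ki}^2$. Otherwise $\mathfrak{g}$ is degenerate. Metaflat: with $\mathrm{ad}_x(y\wedge z)=[x,y]\wedge z+y\wedge[x,z]$ on $\wedge^2\mathfrak{g}$, the flat Lie algebra $\mathfrak{g}$ endowed with a $1$-cocycle $\xi:\mathfrak{g}\to\wedge^2\mathfrak{g}$ is metaflat if $\mathrm{ad}_x\mathrm{ad}_y\xi(z)=0$ for all $x,y,z\in\mathfrak{s}$. *)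

theory Defs
  imports "HOL-Analysis.Analysis"
begin

section \<open>The exterior square\<close>

text \<open>
  In finite dimension the exterior square of a real vector space is canonically the space of
  alternating bilinear forms on the dual space; the dual is the type of (bounded) linear functionals.
  No scalar product enters this identification.  That it is the right object is the content of
  \<open>wedge_universal\<close> below.
\<close>

typedef (overloaded) 'a bivector =
  "{B :: ('a::euclidean_space \<Rightarrow>\<^sub>L real) \<Rightarrow> ('a \<Rightarrow>\<^sub>L real) \<Rightarrow> real.
      bilinear B \<and> (\<forall>\<alpha>. B \<alpha> \<alpha> = 0)}"
  morphisms bivector_form Abs_bivector
  by (rule exI[of _ "\<lambda>_ _. 0"]) (simp add: bilinear_def linear_iff)

setup_lifting type_definition_bivector

instantiation bivector :: (euclidean_space) real_vector
begin

lift_definition zero_bivector :: "'a bivector" is "\<lambda>_ _. 0"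
  by (simp add: bilinear_def linear_iff)

lift_definition plus_bivector :: "'a bivector \<Rightarrow> 'a bivector \<Rightarrow> 'a bivector"
  is "\<lambda>B C \<alpha> \<beta>. B \<alpha> \<beta> + C \<alpha> \<beta>"
  by (auto simp: bilinear_def linear_iff algebra_simps)

lift_definition minus_bivector :: "'a bivector \<Rightarrow> 'a bivector \<Rightarrow> 'a bivector"
  is "\<lambda>B C \<alpha> \<beta>. B \<alpha> \<beta> - C \<alpha> \<beta>"
  by (auto simp: bilinear_def linear_iff algebra_simps)

lift_definition uminus_bivector :: "'a bivector \<Rightarrow> 'a bivector"
  is "\<lambda>B \<alpha> \<beta>. - B \<alpha> \<beta>"
  by (auto simp: bilinear_def linear_iff algebra_simps)

lift_definition scaleR_bivector :: "real \<Rightarrow> 'a bivector \<Rightarrow> 'a bivector"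
  is "\<lambda>c B \<alpha> \<beta>. c * B \<alpha> \<beta>"
  by (auto simp: bilinear_def linear_iff algebra_simps)

instance
  by standard (transfer; simp add: algebra_simps)+

end

lift_definition wedge :: "'a::euclidean_space \<Rightarrow> 'a \<Rightarrow> 'a bivector"
  is "\<lambda>x y \<alpha> \<beta>. blinfun_apply \<alpha> x * blinfun_apply \<beta> y - blinfun_apply \<alpha> y * blinfun_apply \<beta> x"
  by (auto simp: bilinear_def linear_iff algebra_simps blinfun.bilinear_simps)

lemma bilinear_wedge: "bilinear (wedge :: 'a::euclidean_space \<Rightarrow> 'a \<Rightarrow> 'a bivector)"
  unfolding bilinear_def linear_iff
  by (intro conjI allI; transfer; simp add: algebra_simps blinfun.bilinear_simps)

lemma wedge_self [simp]: "wedge x x = 0"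
  by transfer simp

lemma bivector_form_sum: "bivector_form (\<Sum>i\<in>A. f i) \<alpha> \<beta> = (\<Sum>i\<in>A. bivector_form (f i) \<alpha> \<beta>)"
  by (induction A rule: infinite_finite_induct)
     (simp_all add: zero_bivector.rep_eq plus_bivector.rep_eq)

lemma blinfun_euclidean_expansion:
  fixes \<alpha> :: "'a::euclidean_space \<Rightarrow>\<^sub>L real"
  shows "\<alpha> = (\<Sum>b\<in>Basis. blinfun_apply \<alpha> b *\<^sub>R blinfun_inner_left b)"
proof (rule blinfun_eqI)
  fix x :: 'a
  have "blinfun_apply \<alpha> x = blinfun_apply \<alpha> (\<Sum>b\<in>Basis. (x \<bullet> b) *\<^sub>R b)"
    by (simp add: euclidean_representation)
  also have "\<dots> = (\<Sum>b\<in>Basis. (x \<bullet> b) * blinfun_apply \<alpha> b)"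
    by (simp only: blinfun.sum_right blinfun.scaleR_right real_scaleR_def)
  finally show "blinfun_apply \<alpha> x
      = blinfun_apply (\<Sum>b\<in>Basis. blinfun_apply \<alpha> b *\<^sub>R blinfun_inner_left b) x"
    by (simp add: blinfun.sum_left blinfun.scaleR_left mult.commute)
qed

lemma bivector_expansion:
  fixes r :: "'a::euclidean_space bivector"
  shows "r = (\<Sum>b\<in>Basis. \<Sum>c\<in>Basis.
    (bivector_form r (blinfun_inner_left b) (blinfun_inner_left c) / 2) *\<^sub>R wedge b c)"
    (is "r = ?R")
proof -
  let ?B = "bivector_form r"
  have bil: "bilinear ?B" and alt: "\<And>\<alpha>. ?B \<alpha> \<alpha> = 0"
    using bivector_form[of r] by auto
  have anti: "?B \<beta> \<alpha> = - ?B \<alpha> \<beta>" for \<alpha> \<beta>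
    using alt[of "\<alpha> + \<beta>"] alt[of \<alpha>] alt[of \<beta>] bil
    by (simp add: bilinear_ladd bilinear_radd)
  have expand: "?B \<alpha> \<beta> = (\<Sum>b\<in>Basis. \<Sum>c\<in>Basis. (\<alpha> b * \<beta> c) *
      ?B (blinfun_inner_left b) (blinfun_inner_left c))" for \<alpha> \<beta>
  proof -
    have "?B \<alpha> \<beta> = ?B (\<Sum>b\<in>Basis. \<alpha> b *\<^sub>R blinfun_inner_left b)
        (\<Sum>c\<in>Basis. \<beta> c *\<^sub>R blinfun_inner_left c)"
      by (simp only: blinfun_euclidean_expansion[symmetric])
    also have "\<dots> = (\<Sum>(b, c)\<in>Basis \<times> Basis.
        ?B (\<alpha> b *\<^sub>R blinfun_inner_left b) (\<beta> c *\<^sub>R blinfun_inner_left c))"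
      by (rule bilinear_sum[OF bil])
    also have "\<dots> = (\<Sum>b\<in>Basis. \<Sum>c\<in>Basis. (\<alpha> b * \<beta> c) *
        ?B (blinfun_inner_left b) (blinfun_inner_left c))"
      by (simp add: sum.cartesian_product bilinear_lmul[OF bil] bilinear_rmul[OF bil] ac_simps)
    finally show ?thesis .
  qed
  have "bivector_form ?R \<alpha> \<beta> = ?B \<alpha> \<beta>" for \<alpha> \<beta>
  proof -
    have "bivector_form ?R \<alpha> \<beta> = (\<Sum>b\<in>Basis. \<Sum>c\<in>Basis.
        (?B (blinfun_inner_left b) (blinfun_inner_left c) / 2) * (\<alpha> b * \<beta> c - \<alpha> c * \<beta> b))"
      by (simp add: bivector_form_sum scaleR_bivector.rep_eq wedge.rep_eq)
    also have "\<dots> = (\<Sum>b\<in>Basis. \<Sum>c\<in>Basis.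
          (\<alpha> b * \<beta> c) * ?B (blinfun_inner_left b) (blinfun_inner_left c)) / 2
        - (\<Sum>b\<in>Basis. \<Sum>c\<in>Basis.
          (\<beta> b * \<alpha> c) * ?B (blinfun_inner_left b) (blinfun_inner_left c)) / 2"
      by (simp add: sum_divide_distrib sum_subtractf[symmetric] algebra_simps diff_divide_distrib)
    also have "\<dots> = ?B \<alpha> \<beta> / 2 - ?B \<beta> \<alpha> / 2"
      by (simp only: expand[of \<alpha> \<beta>] expand[of \<beta> \<alpha>])
    finally show ?thesis
      using anti[of \<alpha> \<beta>] by simp
  qed
  then have "bivector_form ?R = ?B" by blast
  then show ?thesis by (simp only: bivector_form_inject)
qed

theorem wedge_universal:
  fixes f :: "'a::euclidean_space \<Rightarrow> 'a \<Rightarrow> 'b::real_vector"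
  assumes bil: "bilinear f" and alt: "\<And>x. f x x = 0"
  shows "\<exists>!F. linear F \<and> (\<forall>x y. F (wedge x y) = f x y)"
proof (rule ex_ex1I)
  define F where "F r = (\<Sum>b\<in>Basis. \<Sum>c\<in>Basis.
    (bivector_form r (blinfun_inner_left b) (blinfun_inner_left c) / 2) *\<^sub>R f b c)" for r
  have lin: "linear F"
    unfolding linear_iff F_def
    by (simp add: plus_bivector.rep_eq scaleR_bivector.rep_eq add_divide_distrib
        scaleR_add_left sum.distrib scaleR_right.sum)
  have anti: "f y x = - f x y" for x y
  proof -
    have "f x y + f y x = 0"
      using alt[of "x + y"] alt[of x] alt[of y] bil
      by (simp add: bilinear_ladd bilinear_radd add.commute)
    then show ?thesis by (simp add: add_eq_0_iff)
  qed
  have expand: "f x y = (\<Sum>b\<in>Basis. \<Sum>c\<in>Basis. ((x \<bullet> b) * (y \<bullet> c)) *\<^sub>R f b c)" for x y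
  proof -
    have "f x y = f (\<Sum>b\<in>Basis. (x \<bullet> b) *\<^sub>R b) (\<Sum>c\<in>Basis. (y \<bullet> c) *\<^sub>R c)"
      by (simp add: euclidean_representation)
    also have "\<dots> = (\<Sum>(b, c)\<in>Basis \<times> Basis. f ((x \<bullet> b) *\<^sub>R b) ((y \<bullet> c) *\<^sub>R c))"
      by (rule bilinear_sum[OF bil])
    finally show ?thesis
      by (simp add: sum.cartesian_product bilinear_lmul[OF bil] bilinear_rmul[OF bil] mult.commute)
  qed
  have "F (wedge x y) = f x y" for x y
  proof -
    have "F (wedge x y) = (\<Sum>b\<in>Basis. \<Sum>c\<in>Basis.
        (1/2) *\<^sub>R (((x \<bullet> b) * (y \<bullet> c)) *\<^sub>R f b c) - (1/2) *\<^sub>R (((y \<bullet> b) * (x \<bullet> c)) *\<^sub>R f b c))"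
      unfolding F_def
      by (intro sum.cong refl)
         (simp add: wedge.rep_eq scaleR_left_diff_distrib[symmetric] diff_divide_distrib
           mult.commute)
    also have "\<dots> = (1/2) *\<^sub>R f x y - (1/2) *\<^sub>R f y x"
      unfolding expand[of x y] expand[of y x]
      by (simp add: sum_subtractf scaleR_right.sum)
    also have "\<dots> = f x y"
      by (simp add: anti[of y x] scaleR_add_left[symmetric])
    finally show ?thesis .
  qed
  with lin show "\<exists>F. linear F \<and> (\<forall>x y. F (wedge x y) = f x y)" by blast
next
  fix F G :: "'a bivector \<Rightarrow> 'b"
  assume F: "linear F \<and> (\<forall>x y. F (wedge x y) = f x y)"
    and G: "linear G \<and> (\<forall>x y. G (wedge x y) = f x y)"
  show "F = G"
  proof
    fix r :: "'a bivector"
    have "H r = (\<Sum>b\<in>Basis. \<Sum>c\<in>Basis.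
        (bivector_form r (blinfun_inner_left b) (blinfun_inner_left c) / 2) *\<^sub>R f b c)"
      if "linear H \<and> (\<forall>x y. H (wedge x y) = f x y)" for H
      using that by (subst bivector_expansion[of r]) (simp add: linear_sum linear_cmul)
    from this[OF F] this[OF G] show "F r = G r" by simp
  qed
qed

section \<open>Flat Lie algebras\<close>

text \<open>
  The underlying metric vector space is a type of class \<open>euclidean_space\<close>, i.e. an arbitrary
  finite-dimensional real vector space (of positive dimension) with a positive definite scalar product.
\<close>

locale lie_algebra =
  fixes br :: "'a::euclidean_space \<Rightarrow> 'a \<Rightarrow> 'a"
  assumes bilinear_br: "bilinear br"
    and br_self: "br x x = 0"
    and jacobi: "br x (br y z) + br y (br z x) + br z (br x y) = 0"

definition levi_civita :: "('a::euclidean_space \<Rightarrow> 'a \<Rightarrow> 'a) \<Rightarrow> 'a \<Rightarrow> 'a \<Rightarrow> 'a" where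
  "levi_civita br x y =
    (THE w. \<forall>z. 2 * (w \<bullet> z) = br x y \<bullet> z + br z x \<bullet> y + br z y \<bullet> x)"

locale flat_lie_algebra = lie_algebra +
  assumes flat: "levi_civita br (br x y) z
    - (levi_civita br x (levi_civita br y z) - levi_civita br y (levi_civita br x z)) = 0"

definition lie_center :: "('a::euclidean_space \<Rightarrow> 'a \<Rightarrow> 'a) \<Rightarrow> 'a set" where
  "lie_center br = {x. \<forall>y. br x y = 0}"

definition lie_derived :: "('a::euclidean_space \<Rightarrow> 'a \<Rightarrow> 'a) \<Rightarrow> 'a set" where
  "lie_derived br = span {br x y | x y. True}"

definition lie_s :: "('a::euclidean_space \<Rightarrow> 'a \<Rightarrow> 'a) \<Rightarrow> 'a set" where
  "lie_s br = orthogonal_comp (span (lie_center br \<union> lie_derived br))"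

text \<open>Families are indexed from 1; their values outside \<open>{1..n}\<close> are irrelevant.\<close>

definition indexed_basis :: "'a::euclidean_space set \<Rightarrow> nat \<Rightarrow> (nat \<Rightarrow> 'a) \<Rightarrow> bool" where
  "indexed_basis V n v \<longleftrightarrow>
    inj_on v {1..n} \<and> independent (v ` {1..n}) \<and> span (v ` {1..n}) = V"

definition adapted_basis ::
  "('a::euclidean_space \<Rightarrow> 'a \<Rightarrow> 'a) \<Rightarrow> nat \<Rightarrow> (nat \<Rightarrow> 'a) \<Rightarrow> nat \<Rightarrow> (nat \<Rightarrow> 'a) \<Rightarrow>
    nat \<Rightarrow> (nat \<Rightarrow> 'a) \<Rightarrow> (nat \<Rightarrow> nat \<Rightarrow> real) \<Rightarrow> bool" where
  "adapted_basis br k0 s l0 z m d lam \<longleftrightarrow>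
    indexed_basis (lie_s br) k0 s \<and>
    indexed_basis (lie_center br) l0 z \<and>
    indexed_basis (lie_derived br) (2 * m) d \<and>
    (\<forall>i\<in>{1..2*m}. \<forall>j\<in>{1..2*m}. d i \<bullet> d j = (if i = j then 1 else 0)) \<and>
    (\<forall>i\<in>{1..k0}. \<forall>j\<in>{1..m}.
      br (s i) (d (2*j - 1)) = lam i j *\<^sub>R d (2*j) \<and>
      br (s i) (d (2*j)) = - lam i j *\<^sub>R d (2*j - 1))"

text \<open>
  Relative to the linear forms \<open>\<lambda>\<^sub>1, \<dots>, \<lambda>\<^sub>m\<close>, the choice of the orthonormal basis \<open>d\<close> only
  affects their order and signs, and the condition below is invariant under both.  Quantifying over
  whole adapted bases therefore amounts to quantifying over the bases of \<open>lie_s br\<close>, and makes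
  nondegeneracy a property of the Lie algebra alone.
\<close>

definition nondegenerate :: "('a::euclidean_space \<Rightarrow> 'a \<Rightarrow> 'a) \<Rightarrow> bool" where
  "nondegenerate br \<longleftrightarrow> (\<exists>k0 s l0 z m d lam. adapted_basis br k0 s l0 z m d lam \<and>
    (\<forall>i\<in>{1..m}. \<forall>j\<in>{1..m}. i \<noteq> j \<longrightarrow> (\<exists>k\<in>{1..k0}. (lam k j)\<^sup>2 \<noteq> (lam k i)\<^sup>2)))"

abbreviation degenerate :: "('a::euclidean_space \<Rightarrow> 'a \<Rightarrow> 'a) \<Rightarrow> bool" where
  "degenerate br \<equiv> \<not> nondegenerate br"

section \<open>Metaflat Lie algebras\<close>

definition ad2 :: "('a::euclidean_space \<Rightarrow> 'a \<Rightarrow> 'a) \<Rightarrow> 'a \<Rightarrow> 'a bivector \<Rightarrow> 'a bivector" where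
  "ad2 br x = (THE F. linear F \<and>
    (\<forall>y z. F (wedge y z) = wedge (br x y) z + wedge y (br x z)))"

definition cocycle1 ::
  "('a::euclidean_space \<Rightarrow> 'a \<Rightarrow> 'a) \<Rightarrow> ('a \<Rightarrow> 'a bivector) \<Rightarrow> bool" where
  "cocycle1 br \<xi> \<longleftrightarrow> linear \<xi> \<and>
    (\<forall>x y. \<xi> (br x y) = ad2 br x (\<xi> y) - ad2 br y (\<xi> x))"

locale metaflat = flat_lie_algebra br for br :: "'a::euclidean_space \<Rightarrow> 'a \<Rightarrow> 'a" +
  fixes \<xi> :: "'a \<Rightarrow> 'a bivector"
  assumes cocycle: "cocycle1 br \<xi>"
    and metaflat_cond: "\<lbrakk>x \<in> lie_s br; y \<in> lie_s br; z \<in> lie_s br\<rbrakk>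
      \<Longrightarrow> ad2 br x (ad2 br y (\<xi> z)) = 0"

section \<open>The definite descriptions denote, and coboundaries are cocycles\<close>

context lie_algebra
begin

lemma br_anti: "br y x = - br x y"
proof -
  have "br x y + br y x = 0"
    using br_self[of "x + y"] br_self[of x] br_self[of y] bilinear_br
    by (simp add: bilinear_ladd bilinear_radd add.commute)
  then show ?thesis by (simp add: add_eq_0_iff)
qed

lemma levi_civita_iff:
  "levi_civita br x y = w \<longleftrightarrow>
    (\<forall>z. 2 * (w \<bullet> z) = br x y \<bullet> z + br z x \<bullet> y + br z y \<bullet> x)"
proof -
  let ?P = "\<lambda>w. \<forall>z. 2 * (w \<bullet> z) = br x y \<bullet> z + br z x \<bullet> y + br z y \<bullet> x"
  let ?f = "\<lambda>z. (br x y \<bullet> z + br z x \<bullet> y + br z y \<bullet> x) / 2"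
  have lin: "linear ?f"
    using bilinear_br
    by (simp add: linear_iff bilinear_ladd bilinear_lmul inner_simps algebra_simps
        add_divide_distrib)
  define v where "v = (\<Sum>b\<in>Basis. ?f b *\<^sub>R b)"
  have "?P v"
  proof
    fix z
    have "?f z = ?f (\<Sum>b\<in>Basis. (z \<bullet> b) *\<^sub>R b)"
      by (simp add: euclidean_representation)
    also have "\<dots> = (\<Sum>b\<in>Basis. (z \<bullet> b) * ?f b)"
      by (simp only: linear_sum[OF lin] linear_cmul[OF lin] real_scaleR_def)
    also have "\<dots> = v \<bullet> z"
      unfolding v_def inner_sum_left inner_scaleR_left by (simp add: inner_commute mult.commute)
    finally show "2 * (v \<bullet> z) = br x y \<bullet> z + br z x \<bullet> y + br z y \<bullet> x" by simp
  qed
  moreover have "w = w'" if "?P w" "?P w'" for w w'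
  proof -
    have "w \<bullet> z = w' \<bullet> z" for z using that[rule_format, of z] by simp
    then show ?thesis by (metis vector_eq_rdot)
  qed
  ultimately have "\<exists>!w. ?P w" by blast
  then show ?thesis
    unfolding levi_civita_def using theI'[of ?P] the1_equality[of ?P w] by blast
qed

lemma levi_civita: "2 * (levi_civita br x y \<bullet> z) = br x y \<bullet> z + br z x \<bullet> y + br z y \<bullet> x"
  using levi_civita_iff by blast

lemma linear_ad2: "linear (ad2 br x)"
  and ad2_wedge: "ad2 br x (wedge y z) = wedge (br x y) z + wedge y (br x z)"
proof -
  have "wedge a b = - wedge b a" for a b :: 'a
    by transfer (auto simp: algebra_simps)
  from this[of "br x _"] have "wedge (br x y) y + wedge y (br x y) = 0" for y
    by simp
  moreover have "bilinear (\<lambda>y z. wedge (br x y) z + wedge y (br x z))"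
    unfolding bilinear_def linear_iff
    by (simp add: bilinear_ladd[OF bilinear_wedge] bilinear_radd[OF bilinear_wedge]
        bilinear_lmul[OF bilinear_wedge] bilinear_rmul[OF bilinear_wedge]
        bilinear_radd[OF bilinear_br] bilinear_rmul[OF bilinear_br] algebra_simps)
  ultimately have "\<exists>!F. linear F \<and>
      (\<forall>y z. F (wedge y z) = wedge (br x y) z + wedge y (br x z))"
    by (intro wedge_universal)
  from theI'[OF this] show "linear (ad2 br x)"
    and "ad2 br x (wedge y z) = wedge (br x y) z + wedge y (br x z)"
    by (simp_all add: ad2_def)
qed

lemma bivector_linear_eqI:
  fixes F G :: "'a bivector \<Rightarrow> 'b::real_vector"
  assumes "linear F" "linear G" "\<And>x y. F (wedge x y) = G (wedge x y)"
  shows "F r = G r"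
  using assms by (subst (1 2) bivector_expansion[of r]) (simp add: linear_sum linear_cmul)

lemma cocycle1_coboundary: "cocycle1 br (\<lambda>x. ad2 br x r)"
proof -
  note w = bilinear_ladd[OF bilinear_wedge] bilinear_radd[OF bilinear_wedge]
    bilinear_lmul[OF bilinear_wedge] bilinear_rmul[OF bilinear_wedge]
    bilinear_lsub[OF bilinear_wedge] bilinear_rsub[OF bilinear_wedge]
  note b = bilinear_ladd[OF bilinear_br] bilinear_lmul[OF bilinear_br]
  note l = linear_ad2[THEN linear_add] linear_ad2[THEN linear_cmul]
  have "ad2 br (x + y) r = ad2 br x r + ad2 br y r" for x y
    by (rule bivector_linear_eqI)
       (auto simp: linear_ad2 linear_compose_add ad2_wedge w b)
  moreover have "ad2 br (c *\<^sub>R x) r = c *\<^sub>R ad2 br x r" for c x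
    by (rule bivector_linear_eqI)
       (auto simp: linear_ad2 linear_compose_scale_right ad2_wedge w b scaleR_add_right)
  moreover have "ad2 br (br x y) r = ad2 br x (ad2 br y r) - ad2 br y (ad2 br x r)" for x y
  proof (rule bivector_linear_eqI[where F = "ad2 br (br x y)"
        and G = "\<lambda>r. ad2 br x (ad2 br y r) - ad2 br y (ad2 br x r)"])
    have "br (br x y) u = br x (br y u) - br y (br x u)" for u
      using jacobi[of x y u] br_anti[of "br x y" u] br_anti[of u x]
      by (simp add: bilinear_rneg[OF bilinear_br] neg_eq_iff_add_eq_0 algebra_simps)
    then show "ad2 br (br x y) (wedge u v)
        = ad2 br x (ad2 br y (wedge u v)) - ad2 br y (ad2 br x (wedge u v))" for u v
      by (simp add: ad2_wedge l w)
    show "linear (\<lambda>r. ad2 br x (ad2 br y r) - ad2 br y (ad2 br x r))"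
      by (intro linear_compose_sub linear_compose[OF linear_ad2 linear_ad2, unfolded o_def])
  qed (rule linear_ad2)
  ultimately show ?thesis
    by (simp add: cocycle1_def linear_iff)
qed

end

end

theory Submission
  imports Defs
begin

text \<open>
  For \<open>x\<close> in \<open>\<ss>\<close> the operator \<open>ad\<^sub>x\<close> of a flat Lie algebra is skew, hence so is its action on
  bivectors.  A skew operator \<open>A\<close> with \<open>A\<^sup>3 r = 0\<close> satisfies \<open>A r = 0\<close>, so the metaflat condition with
  all three arguments equal to \<open>x\<close> already says that \<open>r\<close> is invariant under every \<open>ad\<^sub>x\<close>
  (\<open>ad2_power_kernel\<close>).  The rest is the computation of the invariant bivectors: \<open>\<ss>\<close> acts trivially
  on \<open>\<ss> \<oplus> \<zz>\<close> and by a rotation of speed \<open>\<lambda>\<^sub>i\<close> on the plane spanned by the \<open>i\<close>-th pair of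
  \<open>\<dd>\<close>.  Since no \<open>\<lambda>\<^sub>i\<close> vanishes identically, an invariant bivector has no component mixing
  \<open>\<ss> \<oplus> \<zz>\<close> with \<open>\<dd>\<close> (\<open>coeff_proj_sz_d\<close>).  Its components in the planes \<open>i\<close> and \<open>j\<close> satisfy a
  linear system with determinants \<open>\<lambda>\<^sub>i\<^sup>2 - \<lambda>\<^sub>j\<^sup>2\<close>: they vanish unless \<open>\<lambda>\<^sub>j = \<plusminus>\<lambda>\<^sub>i\<close> as linear
  forms (\<open>block_zero\<close>), and in that case the sign ties them together in pairs (\<open>block_sign\<close>).

  That \<open>ad\<^sub>x\<close> is skew, that \<open>\<ss>\<close> and \<open>\<dd>\<close> are abelian and that the center is orthogonal to \<open>\<dd>\<close> must
  be derived from flatness.  Following Milnor, let \<open>\<uu>\<close> be the kernel of \<open>x \<mapsto> \<nabla>\<^sub>x\<close>, an abelian ideal,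
  and \<open>\<bb>\<close> its orthogonal complement, a subalgebra on which the trace form
  \<open>- tr (\<nabla>\<^sub>x \<nabla>\<^sub>y)\<close> is positive definite and invariant.  The key point is that \<open>\<nabla>\<close> vanishes on
  \<open>\<bb> \<times> \<bb>\<close> (\<open>nab_vanishes_on_parallel_comp\<close>); it is proved with a Casimir operator.  From it
  follow \<open>\<bb> = \<ss>\<close> and \<open>\<uu> = \<zz> \<oplus> \<dd>\<close>.

  The nondegeneracy hypothesis speaks of some adapted basis, the conclusion of a given one.  The
  bridge is \<open>weights_distinct\<close>: two weights of the given basis equal up to sign would produce four
  independent vectors in a joint eigenspace that nondegeneracy allows to have dimension two only.
\<close>

section \<open>Orthonormal bases and traces\<close>

text \<open>
  A \<open>B\<close>-orthonormal family of maximal cardinality spans \<open>V\<close>: otherwise the normalized residue of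
  the projection of some vector would extend it.
\<close>

lemma orthonormal_basis_of_form:
  fixes B :: "'a::euclidean_space \<Rightarrow> 'a \<Rightarrow> real"
  assumes V: "subspace V" and bil: "bilinear B" and sym: "\<And>x y. B x y = B y x"
    and pos: "\<And>x. x \<in> V \<Longrightarrow> x \<noteq> 0 \<Longrightarrow> B x x > 0"
  obtains E where "finite E" "E \<subseteq> V"
    "\<And>e f. e \<in> E \<Longrightarrow> f \<in> E \<Longrightarrow> B e f = (if e = f then 1 else 0)"
    "\<And>x. x \<in> V \<Longrightarrow> x = (\<Sum>e\<in>E. B x e *\<^sub>R e)"
proof -
  define ON where "ON E \<longleftrightarrow> finite E \<and> E \<subseteq> V \<and>
    (\<forall>e\<in>E. \<forall>f\<in>E. B e f = (if e = f then 1 else 0))" for E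
  have lsum: "B (\<Sum>e\<in>E. c e *\<^sub>R e) f = (\<Sum>e\<in>E. c e * B e f)" for E c f
  proof -
    have l: "linear (\<lambda>x. B x f)" using bil by (simp add: bilinear_def)
    show ?thesis by (simp add: linear_sum[OF l] linear_cmul[OF l])
  qed
  have proj: "B (\<Sum>e\<in>E. c e *\<^sub>R e) f = c f" if "ON E" "f \<in> E" for E c f
  proof -
    have "B (\<Sum>e\<in>E. c e *\<^sub>R e) f = (\<Sum>e\<in>E. if e = f then c e else 0)"
      unfolding lsum by (rule sum.cong) (use that in \<open>auto simp: ON_def\<close>)
    then show ?thesis using that by (simp add: ON_def)
  qed
  have bound: "card E \<le> DIM('a)" if "ON E" for E
  proof -
    have "independent E"
    proof (rule independent_if_scalars_zero)
      show "finite E" using that by (simp add: ON_def)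
      fix c e assume "(\<Sum>x\<in>E. c x *\<^sub>R x) = 0" "e \<in> E"
      then show "c e = 0" using proj[OF that, of e c] bil by (simp add: bilinear_lzero)
    qed
    then show ?thesis using independent_bound by blast
  qed
  have "ON {}" by (simp add: ON_def)
  then obtain E where E: "ON E" and max: "\<And>F. ON F \<Longrightarrow> card F \<le> card E"
    using bound ex_has_greatest_nat[of ON "{}" card "DIM('a) + 1"] by force
  have "x = (\<Sum>e\<in>E. B x e *\<^sub>R e)" if "x \<in> V" for x
  proof (rule ccontr)
    assume "x \<noteq> (\<Sum>e\<in>E. B x e *\<^sub>R e)"
    define y where "y = x - (\<Sum>e\<in>E. B x e *\<^sub>R e)"
    have "y \<noteq> 0" using \<open>x \<noteq> _\<close> by (simp add: y_def)
    have "y \<in> V" using E V that unfolding y_def ON_def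
      by (auto intro!: subspace_diff subspace_sum subspace_scale)
    have yE: "B y f = 0" if "f \<in> E" for f
      using proj[OF E that] by (simp add: y_def bilinear_lsub[OF bil])
    define g where "g = (1 / sqrt (B y y)) *\<^sub>R y"
    have "B y y > 0" using pos \<open>y \<in> V\<close> \<open>y \<noteq> 0\<close> by blast
    then have gg: "B g g = 1"
      by (simp add: g_def bilinear_lmul[OF bil] bilinear_rmul[OF bil] divide_simps)
    have gE: "B g f = 0" "B f g = 0" if "f \<in> E" for f
      using yE[OF that] sym[of f] by (simp_all add: g_def bilinear_lmul[OF bil])
    have "g \<notin> E" using gE gg by force
    moreover have "ON (insert g E)"
      using E gE gg \<open>g \<notin> E\<close> \<open>y \<in> V\<close> V unfolding ON_def
      by (auto simp: g_def intro: subspace_scale)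
    ultimately show False using max[of "insert g E"] E by (simp add: ON_def)
  qed
  with E show thesis by (intro that[of E]) (auto simp: ON_def)
qed

lemma sum_Basis_expand:
  fixes f :: "'a::euclidean_space \<Rightarrow> 'b::real_vector"
  assumes "linear f"
  shows "(\<Sum>e\<in>Basis. (x \<bullet> e) *\<^sub>R f e) = f x"
proof -
  have "f x = f (\<Sum>e\<in>Basis. (x \<bullet> e) *\<^sub>R e)" by (simp add: euclidean_representation)
  then show ?thesis by (simp add: linear_sum[OF assms] linear_cmul[OF assms])
qed

lemma trace_commute:
  fixes S T :: "'a::euclidean_space \<Rightarrow> 'a"
  assumes "linear S" "linear T"
  shows "(\<Sum>e\<in>Basis. S (T e) \<bullet> e) = (\<Sum>e\<in>Basis. T (S e) \<bullet> e)"
proof -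
  have *: "(\<Sum>e\<in>Basis. S (T e) \<bullet> e) = (\<Sum>e\<in>Basis. \<Sum>c\<in>Basis. (T e \<bullet> c) * (S c \<bullet> e))"
    if "linear S" for S T :: "'a \<Rightarrow> 'a"
    by (rule sum.cong[OF refl], subst sum_Basis_expand[OF that, symmetric])
       (simp add: inner_sum_left)
  show ?thesis
    unfolding *[OF assms(1)] *[OF assms(2)] by (subst sum.swap) (simp add: mult.commute)
qed

section \<open>The structure of flat Lie algebras\<close>

context lie_algebra
begin

abbreviation nab :: "'a \<Rightarrow> 'a \<Rightarrow> 'a" where "nab \<equiv> levi_civita br"

lemmas br_simps =
  bilinear_ladd[OF bilinear_br] bilinear_radd[OF bilinear_br]
  bilinear_lmul[OF bilinear_br] bilinear_rmul[OF bilinear_br]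
  bilinear_lzero[OF bilinear_br] bilinear_rzero[OF bilinear_br]
  bilinear_lsub[OF bilinear_br] bilinear_rsub[OF bilinear_br]

lemma bilinear_nab: "bilinear nab"
  unfolding bilinear_def linear_iff
proof (intro conjI allI)
  fix x y z and c :: real
  show "nab x (y + z) = nab x y + nab x z" "nab (x + y) z = nab x z + nab y z"
    unfolding levi_civita_iff
    using levi_civita[of x y] levi_civita[of x z] levi_civita[of y z]
    by (auto simp: br_simps inner_simps algebra_simps)
  show "nab x (c *\<^sub>R y) = c *\<^sub>R nab x y" "nab (c *\<^sub>R x) y = c *\<^sub>R nab x y"
    unfolding levi_civita_iff
  proof -
    have "2 * (c *\<^sub>R nab x y \<bullet> z) = c * (2 * (nab x y \<bullet> z))" for z by simp
    then show "\<forall>z. 2 * (c *\<^sub>R nab x y \<bullet> z)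
        = br x (c *\<^sub>R y) \<bullet> z + br z x \<bullet> c *\<^sub>R y + br z (c *\<^sub>R y) \<bullet> x"
      and "\<forall>z. 2 * (c *\<^sub>R nab x y \<bullet> z)
        = br (c *\<^sub>R x) y \<bullet> z + br z (c *\<^sub>R x) \<bullet> y + br z y \<bullet> c *\<^sub>R x"
      by (simp_all only: levi_civita) (simp_all add: br_simps algebra_simps)
  qed
qed

lemmas nab_simps =
  bilinear_ladd[OF bilinear_nab] bilinear_radd[OF bilinear_nab]
  bilinear_lmul[OF bilinear_nab] bilinear_rmul[OF bilinear_nab]
  bilinear_lzero[OF bilinear_nab] bilinear_rzero[OF bilinear_nab]
  bilinear_lsub[OF bilinear_nab] bilinear_rsub[OF bilinear_nab]

lemma linear_nab: "linear (nab x)"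
  using bilinear_nab by (simp add: bilinear_def)

lemma nab_skew: "nab x y \<bullet> z = - (y \<bullet> nab x z)"
proof -
  have "2 * (nab x y \<bullet> z) + 2 * (nab x z \<bullet> y) = 0"
    unfolding levi_civita using br_anti[of y x] br_anti[of z x] br_anti[of y z]
    by (simp add: inner_simps)
  then show ?thesis by (simp add: inner_commute)
qed

lemma nab_self_orthogonal [simp]: "nab x y \<bullet> y = 0"
  using nab_skew[of x y y] by (simp add: inner_commute)

lemma nab_torsion_free: "nab x y - nab y x = br x y"
proof -
  have "2 * ((nab x y - nab y x) \<bullet> z) = 2 * (br x y \<bullet> z)" for z
    using levi_civita[of x y z] levi_civita[of y x z] br_anti[of y x]
    by (simp add: inner_simps algebra_simps)
  then have "\<forall>z. (nab x y - nab y x) \<bullet> z = br x y \<bullet> z" by simp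
  then show ?thesis by (simp only: vector_eq_rdot)
qed

end

context flat_lie_algebra
begin

lemma nab_br: "nab (br x y) v = nab x (nab y v) - nab y (nab x v)"
  using flat[of x y v] by simp

text \<open>
  The kernel of the connection and its orthogonal complement.  They turn out to be \<open>\<zz> \<oplus> \<dd>\<close> and
  \<open>\<ss>\<close>; these names serve until \<open>lie_s_eq\<close> identifies them.
\<close>

definition parallel_ideal :: "'a set" where
  "parallel_ideal = {x. \<forall>y. nab x y = 0}"

definition parallel_comp :: "'a set" where
  "parallel_comp = orthogonal_comp parallel_ideal"

lemma subspace_parallel_ideal: "subspace parallel_ideal"
  by (auto simp: subspace_def parallel_ideal_def nab_simps)

lemma subspace_parallel_comp: "subspace parallel_comp"
  by (simp add: parallel_comp_def subspace_orthogonal_comp)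

lemma parallel_orthogonal: "x \<in> parallel_comp \<Longrightarrow> v \<in> parallel_ideal \<Longrightarrow> x \<bullet> v = 0"
  by (auto simp: parallel_comp_def orthogonal_comp_def orthogonal_def inner_commute)

lemma parallel_decomp:
  obtains xb xu where "x = xb + xu" "xb \<in> parallel_comp" "xu \<in> parallel_ideal"
proof -
  obtain y w where "y \<in> span parallel_ideal" "\<And>v. v \<in> span parallel_ideal \<Longrightarrow> orthogonal w v"
      "x = y + w"
    using orthogonal_subspace_decomp_exists[of parallel_ideal x] by blast
  then show thesis
    using that[of w y] subspace_parallel_ideal
    by (simp add: parallel_comp_def orthogonal_comp_def orthogonal_commute[of _ w]
        span_eq_iff[THEN iffD2] add.commute)
qed

text \<open>
  Flatness makes \<open>\<nabla>\<close> a representation, so its kernel is an ideal.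
\<close>

lemma br_parallel_ideal: "v \<in> parallel_ideal \<Longrightarrow> br x v \<in> parallel_ideal"
  by (simp add: parallel_ideal_def nab_br nab_simps)

lemma nab_parallel_ideal: "v \<in> parallel_ideal \<Longrightarrow> nab x v = br x v"
  using nab_torsion_free[of x v] by (simp add: parallel_ideal_def)

lemma parallel_ideal_abelian: "u \<in> parallel_ideal \<Longrightarrow> v \<in> parallel_ideal \<Longrightarrow> br u v = 0"
  using nab_torsion_free[of u v] by (simp add: parallel_ideal_def)

lemma nab_parallel_comp: "y \<in> parallel_comp \<Longrightarrow> nab x y \<in> parallel_comp"
proof -
  assume y: "y \<in> parallel_comp"
  have "nab x y \<bullet> v = 0" if "v \<in> parallel_ideal" for v
    using parallel_orthogonal[OF y] br_parallel_ideal[OF that, of x]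
    by (simp add: nab_skew nab_parallel_ideal that)
  then show ?thesis
    by (auto simp: parallel_comp_def orthogonal_comp_def orthogonal_def inner_commute)
qed

lemma br_parallel_comp:
  "x \<in> parallel_comp \<Longrightarrow> y \<in> parallel_comp \<Longrightarrow> br x y \<in> parallel_comp"
  using nab_torsion_free[of x y] nab_parallel_comp subspace_parallel_comp
  by (metis subspace_diff)

text \<open>
  Let \<open>e\<close> run through a basis of \<open>\<bb>\<close> orthonormal for the invariant form \<open>- tr (\<nabla>\<^sub>x \<nabla>\<^sub>y)\<close>, let
  \<open>C = \<Sum>\<^sub>e \<nabla>\<^sub>e \<nabla>\<^sub>e\<close> be the Casimir operator and \<open>w = \<Sum>\<^sub>e \<nabla>\<^sub>e e\<close>.  Torsion-freeness says that the
  identity is a cocycle with values in the representation \<open>\<nabla>\<close>, and the usual computation for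
  cocycles gives \<open>\<nabla>\<^sub>x w = C x\<close> on \<open>\<bb>\<close>.  Pairing \<open>C w = \<nabla>\<^sub>w w\<close> with \<open>w\<close> gives zero on the right and
  \<open>- \<Sum>\<^sub>e |\<nabla>\<^sub>e w|\<^sup>2\<close> on the left.  So \<open>\<nabla>\<^sub>e w = 0\<close>, whence \<open>C x = \<nabla>\<^sub>x w = 0\<close> for all \<open>x\<close> in \<open>\<bb>\<close>, and the same
  pairing for \<open>x\<close> in place of \<open>w\<close> yields \<open>\<nabla>\<^sub>e x = 0\<close>.
\<close>

lemma nab_vanishes_on_parallel_comp:
  assumes x: "x \<in> parallel_comp" and y: "y \<in> parallel_comp"
  shows "nab x y = 0"
proof -
  define B where "B x y = (\<Sum>e\<in>Basis. nab x e \<bullet> nab y e)" for x y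
  have bil: "bilinear B"
    unfolding bilinear_def linear_iff B_def
    by (simp add: nab_simps inner_simps sum.distrib sum_distrib_left)
  have sym: "B x y = B y x" for x y by (simp add: B_def inner_commute)
  have pos: "B x x > 0" if "x \<in> parallel_comp" "x \<noteq> 0" for x
  proof -
    have "B x x \<ge> 0" by (simp add: B_def sum_nonneg)
    moreover have "B x x \<noteq> 0"
    proof
      assume "B x x = 0"
      then have 0: "nab x e = 0" if "e \<in> Basis" for e
        using that by (simp add: B_def sum_nonneg_eq_0_iff)
      have "nab x v = 0" for v
        using sum_Basis_expand[OF linear_nab, of v x] 0 by simp
      then have "x \<in> parallel_ideal" by (simp add: parallel_ideal_def)
      then show False using parallel_orthogonal[OF that(1), of x] that(2) by simp
    qed
    ultimately show ?thesis by simp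
  qed
  have trace: "B x y = - (\<Sum>e\<in>Basis. nab x (nab y e) \<bullet> e)" for x y
    by (simp add: B_def nab_skew[of x] sum_negf inner_commute)
  have inv: "B (br x y) v = - B y (br x v)" for x y v
  proof -
    have "(\<Sum>e\<in>Basis. nab x (nab y (nab v e)) \<bullet> e) = (\<Sum>e\<in>Basis. nab y (nab v (nab x e)) \<bullet> e)"
      using trace_commute[of "nab x" "\<lambda>e. nab y (nab v e)"]
      by (simp add: linear_nab linear_compose[OF linear_nab linear_nab, unfolded o_def])
    then show ?thesis
      by (simp add: trace nab_br nab_simps inner_diff_left sum_subtractf)
  qed
  obtain E where E: "finite E" "E \<subseteq> parallel_comp"
    and ex: "\<And>x. x \<in> parallel_comp \<Longrightarrow> x = (\<Sum>e\<in>E. B x e *\<^sub>R e)"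
    by (rule orthonormal_basis_of_form[OF subspace_parallel_comp bil sym pos]) (assumption, assumption, rule that)
  define w where "w = (\<Sum>e\<in>E. nab e e)"
  have lin1: "linear (\<lambda>x. nab x v)" for v using bilinear_nab by (simp add: bilinear_def)
  have casimir: "nab x w = (\<Sum>e\<in>E. nab e (nab e x))" if x: "x \<in> parallel_comp" for x
  proof -
    \<comment> \<open>\<open>B (br x e) f\<close> is antisymmetric in \<open>e\<close> and \<open>f\<close>, so the two bracket terms cancel.\<close>
    have br_ex: "br x e = (\<Sum>f\<in>E. B (br x e) f *\<^sub>R f)" if "e \<in> E" for e
      using that E x by (intro ex br_parallel_comp) auto
    have "(\<Sum>e\<in>E. nab (br x e) e) = (\<Sum>e\<in>E. \<Sum>f\<in>E. B (br x e) f *\<^sub>R nab f e)"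
      by (intro sum.cong refl, subst br_ex, assumption)
         (simp add: linear_sum[OF lin1] linear_cmul[OF lin1])
    also have "\<dots> = (\<Sum>e\<in>E. \<Sum>f\<in>E. B (br x f) e *\<^sub>R nab e f)"
      by (rule sum.swap)
    also have "\<dots> = (\<Sum>e\<in>E. \<Sum>f\<in>E. - (B (br x e) f *\<^sub>R nab e f))"
      by (intro sum.cong refl) (subst inv, simp add: sym)
    also have "\<dots> = - (\<Sum>e\<in>E. nab e (br x e))"
    proof -
      have "nab e (br x e) = (\<Sum>f\<in>E. B (br x e) f *\<^sub>R nab e f)" if "e \<in> E" for e
        by (subst br_ex[OF that]) (simp add: linear_sum[OF linear_nab] linear_cmul[OF linear_nab])
      then show ?thesis by (simp add: sum_negf)
    qed
    finally have cancel: "(\<Sum>e\<in>E. nab (br x e) e) + (\<Sum>e\<in>E. nab e (br x e)) = 0" by simp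
    have "nab x (nab e e) = nab e (nab e x) + (nab (br x e) e + nab e (br x e))" for e
    proof -
      have "nab x (nab e e) = nab (br x e) e + nab e (nab x e)" using nab_br[of x e e] by simp
      also have "nab x e = br x e + nab e x" using nab_torsion_free[of x e, symmetric] by simp
      finally show ?thesis by (simp add: nab_simps)
    qed
    then show ?thesis
      using cancel by (simp add: w_def linear_sum[OF linear_nab] sum.distrib)
  qed
  have "w \<in> parallel_comp"
    unfolding w_def using E by (intro subspace_sum[OF subspace_parallel_comp] nab_parallel_comp) auto
  have sq: "(\<Sum>e\<in>E. nab e (nab e x)) \<bullet> x = - (\<Sum>e\<in>E. nab e x \<bullet> nab e x)" for x
    by (simp add: inner_sum_left nab_skew[of _ "nab _ x"] sum_negf)
  have null: "nab e x = 0" if "(\<Sum>e\<in>E. nab e (nab e x)) \<bullet> x = 0" "e \<in> E" for x e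
    using that E unfolding sq by (simp add: sum_nonneg_eq_0_iff)
  have "nab e w = 0" if "e \<in> E" for e
    using null[OF _ that, of w] casimir[OF \<open>w \<in> parallel_comp\<close>]
    by (metis nab_self_orthogonal)
  then have "nab v w = 0" if "v \<in> parallel_comp" for v
    by (subst ex[OF that]) (simp add: linear_sum[OF lin1] linear_cmul[OF lin1])
  then have "nab e y = 0" if "e \<in> E" for e
    using null[OF _ that, of y] casimir[OF y] y by (metis inner_zero_left)
  then show ?thesis
    by (subst ex[OF x]) (simp add: linear_sum[OF lin1] linear_cmul[OF lin1])
qed

text \<open>
  For \<open>x\<close> in \<open>\<bb>\<close> the bracket \<open>ad\<^sub>x\<close> coincides with the skew operator \<open>\<nabla>\<^sub>x\<close>: on \<open>\<uu>\<close> because the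
  torsion vanishes, on \<open>\<bb>\<close> because both are zero.
\<close>

lemma br_parallel_comp_skew:
  assumes x: "x \<in> parallel_comp"
  shows "br x y \<bullet> v = - (y \<bullet> br x v)"
proof -
  have "br x y = nab x y" for y
  proof -
    obtain yb yu where y: "y = yb + yu" "yb \<in> parallel_comp" "yu \<in> parallel_ideal"
      using parallel_decomp by metis
    have "br x yb = 0"
      using nab_torsion_free[of x yb] nab_vanishes_on_parallel_comp x y(2) by simp
    then show ?thesis
      using y x by (simp add: br_simps nab_simps nab_parallel_ideal nab_vanishes_on_parallel_comp)
  qed
  then show ?thesis by (simp add: nab_skew)
qed

lemma parallel_comp_abelian: "x \<in> parallel_comp \<Longrightarrow> y \<in> parallel_comp \<Longrightarrow> br x y = 0"
  using nab_torsion_free[of x y] nab_vanishes_on_parallel_comp by simp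

lemma derived_subset: "lie_derived br \<subseteq> parallel_ideal"
  unfolding lie_derived_def
proof (rule span_minimal[OF _ subspace_parallel_ideal], clarify)
  fix x y
  obtain xb xu where x: "x = xb + xu" "xb \<in> parallel_comp" "xu \<in> parallel_ideal"
    using parallel_decomp by metis
  obtain yb yu where y: "y = yb + yu" "yb \<in> parallel_comp" "yu \<in> parallel_ideal"
    using parallel_decomp by metis
  have "br x y = br xb yu - br yb xu"
    using x y by (simp add: br_simps parallel_comp_abelian parallel_ideal_abelian br_anti[of yb xu])
  then show "br x y \<in> parallel_ideal"
    using x y by (simp add: br_parallel_ideal subspace_diff subspace_parallel_ideal)
qed

text \<open>
  The \<open>\<bb>\<close>-component of a central element commutes with \<open>\<uu>\<close>.  As \<open>\<nabla>\<close> vanishes on \<open>\<bb> \<times> \<bb>\<close>, this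
  component lies in \<open>\<uu>\<close> as well.
\<close>

lemma center_subset: "lie_center br \<subseteq> parallel_ideal"
proof
  fix c assume c: "c \<in> lie_center br"
  obtain cb cu where cc: "c = cb + cu" "cb \<in> parallel_comp" "cu \<in> parallel_ideal"
    using parallel_decomp by metis
  have "nab cb y = 0" for y
  proof -
    obtain yb yu where y: "y = yb + yu" "yb \<in> parallel_comp" "yu \<in> parallel_ideal"
      using parallel_decomp by metis
    have "br cb yu = 0"
      using c[unfolded lie_center_def, simplified, rule_format, of yu]
      by (simp add: cc y br_simps parallel_ideal_abelian)
    then show ?thesis
      using cc y by (simp add: nab_simps nab_vanishes_on_parallel_comp nab_parallel_ideal)
  qed
  then have "cb \<in> parallel_ideal" by (simp add: parallel_ideal_def)
  then show "c \<in> parallel_ideal"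
    using cc subspace_parallel_ideal by (simp add: subspace_add)
qed

lemma mem_center_if:
  assumes "v \<in> parallel_ideal" "\<And>x. x \<in> parallel_comp \<Longrightarrow> br x v = 0"
  shows "v \<in> lie_center br"
proof -
  have "br v y = 0" for y
  proof -
    obtain yb yu where y: "y = yb + yu" "yb \<in> parallel_comp" "yu \<in> parallel_ideal"
      using parallel_decomp by metis
    moreover have "br v yb = 0"
      using assms(2)[OF y(2)] br_anti[of yb v] by simp
    ultimately show ?thesis
      using assms(1) by (simp add: br_simps parallel_ideal_abelian)
  qed
  then show ?thesis by (simp add: lie_center_def)
qed

text \<open>
  Both are orthogonal complements, so it suffices that \<open>\<zz> + \<dd>\<close> exhausts \<open>\<uu>\<close>.  A vector \<open>w\<close> of
  \<open>\<uu>\<close> orthogonal to the commutators satisfies \<open>|[x, w]|\<^sup>2 = - \<langle>w, [x, [x, w]]\<rangle> = 0\<close> for \<open>x\<close> in \<open>\<bb>\<close>,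
  so it is central.
\<close>

lemma lie_s_eq: "lie_s br = parallel_comp"
proof -
  let ?W = "span (lie_center br \<union> lie_derived br)"
  have "parallel_ideal = ?W"
  proof
    show "?W \<subseteq> parallel_ideal"
      using center_subset derived_subset subspace_parallel_ideal by (intro span_minimal) auto
    show "parallel_ideal \<subseteq> ?W"
    proof
      fix v assume v: "v \<in> parallel_ideal"
      obtain y w where yw: "y \<in> ?W" "\<And>u. u \<in> ?W \<Longrightarrow> orthogonal w u" "v = y + w"
        using orthogonal_subspace_decomp_exists[of "lie_center br \<union> lie_derived br" v] by blast
      have "w \<in> parallel_ideal"
        using v yw(1,3) \<open>?W \<subseteq> parallel_ideal\<close> subspace_parallel_ideal
        by (metis add_diff_cancel_left' subsetD subspace_diff)
      moreover have "br x w = 0" if "x \<in> parallel_comp" for x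
      proof -
        have "br x (br x w) \<in> ?W"
          by (rule span_base) (auto simp: lie_derived_def intro!: span_base)
        then have "w \<bullet> br x (br x w) = 0" using yw(2) by (simp add: orthogonal_def)
        then show ?thesis using br_parallel_comp_skew[OF that, of w "br x w"] by simp
      qed
      ultimately have "w \<in> lie_center br" by (rule mem_center_if)
      then have "w \<in> ?W" by (simp add: span_base)
      then show "v \<in> ?W" using yw by (simp add: span_add)
    qed
  qed
  then show ?thesis by (simp add: lie_s_def parallel_comp_def)
qed

lemma br_lie_s_skew: "x \<in> lie_s br \<Longrightarrow> br x y \<bullet> v = - (y \<bullet> br x v)"
  by (simp add: lie_s_eq br_parallel_comp_skew)

lemma lie_s_abelian: "x \<in> lie_s br \<Longrightarrow> y \<in> lie_s br \<Longrightarrow> br x y = 0"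
  by (simp add: lie_s_eq parallel_comp_abelian)

lemma center_orthogonal_derived:
  assumes "c \<in> lie_center br" "y \<in> lie_derived br"
  shows "c \<bullet> y = 0"
proof -
  have "lie_derived br \<subseteq> {y. c \<bullet> y = 0}"
    unfolding lie_derived_def
  proof (rule span_minimal[OF _ subspace_hyperplane], clarify)
    fix x y
    obtain xb xu where x: "x = xb + xu" "xb \<in> parallel_comp" "xu \<in> parallel_ideal"
      using parallel_decomp by metis
    obtain yb yu where y: "y = yb + yu" "yb \<in> parallel_comp" "yu \<in> parallel_ideal"
      using parallel_decomp by metis
    have c: "br v c = 0" for v
      using assms(1) br_anti[of c v] by (simp add: lie_center_def)
    have "br x y = br xb yu - br yb xu"
      using x y by (simp add: br_simps parallel_comp_abelian parallel_ideal_abelian br_anti[of yb xu])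
    then show "c \<bullet> br x y = 0"
      using br_parallel_comp_skew[OF x(2), of c yu] br_parallel_comp_skew[OF y(2), of c xu] c
      by (simp add: inner_simps)
  qed
  then show ?thesis using assms by blast
qed

text \<open>
  A vector of \<open>\<dd>\<close> killed by \<open>\<ss>\<close> is central, and the center is orthogonal to \<open>\<dd>\<close>.  This is what
  makes every weight of \<open>\<dd>\<close> nonzero.
\<close>

lemma derived_faithful:
  assumes v: "v \<in> lie_derived br" and "\<And>x. x \<in> lie_s br \<Longrightarrow> br x v = 0"
  shows "v = 0"
proof -
  have "v \<in> lie_center br"
    using assms derived_subset by (intro mem_center_if) (auto simp: lie_s_eq)
  then show ?thesis using center_orthogonal_derived[OF _ v] by force
qed

end

section \<open>Coefficients of a bivector\<close>

text \<open>
  The scalar product turns covectors into vectors, and a bivector into an alternating form on the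
  Lie algebra itself.  In an orthonormal basis its values are the coefficients of the bivector.
\<close>

definition bivector_coeff :: "'a::euclidean_space bivector \<Rightarrow> 'a \<Rightarrow> 'a \<Rightarrow> real" where
  "bivector_coeff r u v = bivector_form r (blinfun_inner_left u) (blinfun_inner_left v)"

lemma bilinear_bivector_coeff: "bilinear (bivector_coeff r)"
proof -
  have B: "bilinear (bivector_form r)" using bivector_form[of r] by simp
  have "blinfun_inner_left (x + y) = blinfun_inner_left x + blinfun_inner_left y"
    "blinfun_inner_left (c *\<^sub>R x) = c *\<^sub>R blinfun_inner_left x" for x y :: 'a and c
    by (auto intro!: blinfun_eqI simp: inner_simps blinfun.bilinear_simps)
  then show ?thesis
    unfolding bilinear_def linear_iff bivector_coeff_def
    by (simp add: bilinear_ladd[OF B] bilinear_radd[OF B] bilinear_lmul[OF B] bilinear_rmul[OF B])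
qed

lemmas bivector_coeff_simps =
  bilinear_ladd[OF bilinear_bivector_coeff] bilinear_radd[OF bilinear_bivector_coeff]
  bilinear_lmul[OF bilinear_bivector_coeff] bilinear_rmul[OF bilinear_bivector_coeff]
  bilinear_lzero[OF bilinear_bivector_coeff] bilinear_rzero[OF bilinear_bivector_coeff]

lemma linear_bivector_coeff_left: "linear (\<lambda>u. bivector_coeff r u v)"
  and linear_bivector_coeff_right: "linear (bivector_coeff r u)"
  using bilinear_bivector_coeff[of r] by (simp_all add: bilinear_def)

lemma bivector_coeff_self [simp]: "bivector_coeff r u u = 0"
  using bivector_form[of r] by (simp add: bivector_coeff_def)

lemma bivector_coeff_anti: "bivector_coeff r v u = - bivector_coeff r u v"
  using bivector_coeff_self[of r "u + v", unfolded bivector_coeff_simps] by simp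

lemma linear_bivector_coeff: "linear (\<lambda>r. bivector_coeff r u v)"
  by (simp add: linear_iff bivector_coeff_def plus_bivector.rep_eq scaleR_bivector.rep_eq)

lemma bivector_coeff_wedge:
  "bivector_coeff (wedge x y) u v = (x \<bullet> u) * (y \<bullet> v) - (y \<bullet> u) * (x \<bullet> v)"
  by (simp add: bivector_coeff_def wedge.rep_eq)

lemma bivector_coeff_expansion:
  "r = (\<Sum>b\<in>Basis. \<Sum>c\<in>Basis. (bivector_coeff r b c / 2) *\<^sub>R wedge b c)"
  using bivector_expansion[of r] by (simp add: bivector_coeff_def)

lemma bivector_eqI:
  assumes "\<And>u v. bivector_coeff r u v = bivector_coeff t u v"
  shows "r = t"
  by (subst bivector_coeff_expansion[of r], subst bivector_coeff_expansion[of t]) (simp add: assms)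

text \<open>
  The sum is the image of \<open>r\<close> under \<open>\<wedge>\<^sup>2 T\<close>.
\<close>

lemma bivector_coeff_pushforward:
  assumes T: "linear T" "linear T'" and adj: "\<And>x y. T x \<bullet> y = x \<bullet> T' y"
  shows "bivector_coeff (\<Sum>b\<in>Basis. \<Sum>c\<in>Basis. (bivector_coeff r b c / 2) *\<^sub>R wedge (T b) (T c)) u v
    = bivector_coeff r (T' u) (T' v)"
proof -
  have "bivector_coeff (\<Sum>b\<in>Basis. \<Sum>c\<in>Basis. (bivector_coeff r b c / 2) *\<^sub>R wedge (T b) (T c)) u v
    = bivector_coeff (\<Sum>b\<in>Basis. \<Sum>c\<in>Basis. (bivector_coeff r b c / 2) *\<^sub>R wedge b c) (T' u) (T' v)"
    by (simp add: linear_sum[OF linear_bivector_coeff] linear_cmul[OF linear_bivector_coeff]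
        bivector_coeff_wedge adj)
  then show ?thesis by (simp flip: bivector_coeff_expansion)
qed

lemma skew_sum_Basis:
  fixes f g :: "'a::euclidean_space \<Rightarrow> real"
  assumes skew: "\<And>x y. A x \<bullet> y = - (x \<bullet> A y)" and f: "linear f" and g: "linear g"
  shows "(\<Sum>e\<in>Basis. f (A e) * g e) = - (\<Sum>e\<in>Basis. f e * g (A e))"
proof -
  have expand: "h (A e) = (\<Sum>c\<in>Basis. (A e \<bullet> c) * h c)" if "linear h" for h :: "'a \<Rightarrow> real" and e
    using sum_Basis_expand[OF that, of "A e"] by simp
  have "(\<Sum>e\<in>Basis. f (A e) * g e) = (\<Sum>e\<in>Basis. \<Sum>c\<in>Basis. (A e \<bullet> c) * f c * g e)"
    by (simp add: expand[OF f] sum_distrib_right)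
  also have "\<dots> = (\<Sum>c\<in>Basis. \<Sum>e\<in>Basis. (A e \<bullet> c) * f c * g e)"
    by (rule sum.swap)
  also have "\<dots> = (\<Sum>c\<in>Basis. \<Sum>e\<in>Basis. - (f c * ((A c \<bullet> e) * g e)))"
    by (intro sum.cong refl) (subst skew, simp add: inner_commute)
  also have "\<dots> = - (\<Sum>e\<in>Basis. f e * g (A e))"
    by (simp add: expand[OF g] sum_distrib_left sum_negf)
  finally show ?thesis .
qed

context flat_lie_algebra
begin

text \<open>
  The signs come from moving \<open>ad\<^sub>x\<close>, which is skew, to the arguments of the form.
\<close>

lemma bivector_coeff_ad2:
  assumes x: "x \<in> lie_s br"
  shows "bivector_coeff (ad2 br x r) u v
    = - bivector_coeff r (br x u) v - bivector_coeff r u (br x v)"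
proof (rule bivector_linear_eqI[where F = "\<lambda>r. bivector_coeff (ad2 br x r) u v"
      and G = "\<lambda>r. - bivector_coeff r (br x u) v - bivector_coeff r u (br x v)"])
  show "linear (\<lambda>r. bivector_coeff (ad2 br x r) u v)"
    using linear_compose[OF linear_ad2 linear_bivector_coeff] by (simp add: o_def)
  show "linear (\<lambda>r. - bivector_coeff r (br x u) v - bivector_coeff r u (br x v))"
    by (intro linear_compose_sub linear_compose_neg linear_bivector_coeff)
  show "bivector_coeff (ad2 br x (wedge a b)) u v = - bivector_coeff (wedge a b) (br x u) v
      - bivector_coeff (wedge a b) u (br x v)" for a b
    by (simp add: ad2_wedge linear_add[OF linear_bivector_coeff] bivector_coeff_wedge
        br_lie_s_skew[OF x] algebra_simps)
qed

text \<open>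
  \<open>ad\<^sub>x\<close> is skew for the scalar product \<open>ip\<close> on bivectors, so the kernel of a power of it is its
  kernel.
\<close>

lemma ad2_power_kernel:
  assumes x: "x \<in> lie_s br" and 3: "ad2 br x (ad2 br x (ad2 br x r)) = 0"
  shows "ad2 br x r = 0"
proof -
  let ?A = "ad2 br x" and ?c = bivector_coeff
  define ip where "ip r t = (\<Sum>b\<in>Basis. \<Sum>c\<in>Basis. ?c r b c * ?c t b c)" for r t :: "'a bivector"
  have skew: "ip (?A r) t = - ip r (?A t)" for r t
  proof -
    have 1: "(\<Sum>b\<in>Basis. \<Sum>c\<in>Basis. ?c r b (br x c) * ?c t b c)
        = - (\<Sum>b\<in>Basis. \<Sum>c\<in>Basis. ?c r b c * ?c t b (br x c))"
      by (simp add: skew_sum_Basis[OF br_lie_s_skew[OF x] linear_bivector_coeff_right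
            linear_bivector_coeff_right] sum_negf)
    have 2: "(\<Sum>b\<in>Basis. \<Sum>c\<in>Basis. ?c r (br x b) c * ?c t b c)
        = - (\<Sum>b\<in>Basis. \<Sum>c\<in>Basis. ?c r b c * ?c t (br x b) c)"
      by (subst (1 2) sum.swap)
        (simp add: skew_sum_Basis[OF br_lie_s_skew[OF x] linear_bivector_coeff_left
            linear_bivector_coeff_left] sum_negf)
    show ?thesis
      using 1 2 by (simp add: ip_def bivector_coeff_ad2[OF x] left_diff_distrib right_diff_distrib
          sum_subtractf sum_negf)
  qed
  have definite: "r = 0" if "ip r r = 0" for r
  proof -
    have "?c r b c = 0" if "b \<in> Basis" "c \<in> Basis" for b c
      using \<open>ip r r = 0\<close> that
      by (simp add: ip_def sum_nonneg_eq_0_iff sum_nonneg)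
    then show "r = 0" by (subst bivector_coeff_expansion[of r]) simp
  qed
  have zero: "ip t 0 = 0" "ip 0 t = 0" for t
    by (simp_all add: ip_def linear_0[OF linear_bivector_coeff])
  have "?A (?A r) = 0"
    using definite[of "?A (?A r)"] skew[of "?A r" "?A (?A r)"] by (simp add: 3 zero)
  then show "?A r = 0"
    using definite[of "?A r"] skew[of r "?A r"] by (simp add: zero)
qed

end

section \<open>Rearranging sums of wedge products\<close>

lemma sum_pairs:
  fixes f :: "nat \<Rightarrow> 'b::comm_monoid_add"
  shows "(\<Sum>a=1..2*m. f a) = (\<Sum>i=1..m. f (2*i - 1) + f (2*i))"
  by (induction m) (simp_all add: ac_simps)

lemma sum_square_triangle:
  fixes h :: "nat \<Rightarrow> nat \<Rightarrow> 'b::comm_monoid_add"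
  assumes "\<And>i. h i i = 0"
  shows "(\<Sum>i=1..n. \<Sum>j=1..n. h i j) = (\<Sum>i=1..n. \<Sum>j\<in>{i<..n}. h i j + h j i)"
proof (induction n)
  case (Suc n)
  have "{i<..Suc n} = insert (Suc n) {i<..n}" if "i \<le> n" for i using that by auto
  then have "(\<Sum>i=1..n. \<Sum>j\<in>{i<..Suc n}. h i j + h j i)
      = (\<Sum>i=1..n. (h i (Suc n) + h (Suc n) i) + (\<Sum>j\<in>{i<..n}. h i j + h j i))"
    by (intro sum.cong refl) simp
  then show ?case
    using Suc.IH assms by (simp add: sum.distrib ac_simps)
qed simp

lemmas wedge_simps =
  bilinear_ladd[OF bilinear_wedge] bilinear_radd[OF bilinear_wedge]
  bilinear_lmul[OF bilinear_wedge] bilinear_rmul[OF bilinear_wedge]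

lemma wedge_anti: "wedge y x = - wedge x y"
  by transfer (auto simp: algebra_simps)

lemma wedge_sum_sum:
  fixes x y :: "nat \<Rightarrow> 'a::euclidean_space"
  shows "wedge (\<Sum>i\<in>A. \<alpha> i *\<^sub>R x i) (\<Sum>j\<in>B. \<beta> j *\<^sub>R y j)
    = (\<Sum>i\<in>A. \<Sum>j\<in>B. (\<alpha> i * \<beta> j) *\<^sub>R wedge (x i) (y j))"
proof -
  have l: "linear (\<lambda>u. wedge u v)" "linear (wedge u)" for u v :: 'a
    using bilinear_wedge[where 'a = 'a] by (simp_all add: bilinear_def)
  have "wedge (\<Sum>i\<in>A. \<alpha> i *\<^sub>R x i) v = (\<Sum>i\<in>A. \<alpha> i *\<^sub>R wedge (x i) v)" for v
    by (simp add: linear_sum[OF l(1)] wedge_simps)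
  then show ?thesis
    by (subst sum.swap) (simp add: linear_sum[OF l(2)] wedge_simps scaleR_right.sum mult.commute)
qed

lemma wedge_sum_triangle:
  fixes x :: "nat \<Rightarrow> 'a::euclidean_space"
  shows "wedge (\<Sum>i=1..n. \<alpha> i *\<^sub>R x i) (\<Sum>i=1..n. \<beta> i *\<^sub>R x i)
    = (\<Sum>i=1..n. \<Sum>j\<in>{i<..n}. (\<alpha> i * \<beta> j - \<alpha> j * \<beta> i) *\<^sub>R wedge (x i) (x j))"
proof -
  have "(\<alpha> i * \<beta> j) *\<^sub>R wedge (x i) (x j) + (\<alpha> j * \<beta> i) *\<^sub>R wedge (x j) (x i)
      = (\<alpha> i * \<beta> j - \<alpha> j * \<beta> i) *\<^sub>R wedge (x i) (x j)" for i j
    using wedge_anti[of "x j" "x i"] by (simp add: algebra_simps)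
  then show ?thesis
    unfolding wedge_sum_sum
    by (subst sum_square_triangle[where h = "\<lambda>i j. (\<alpha> i * \<beta> j) *\<^sub>R wedge (x i) (x j)"])
       simp_all
qed

lemma span_imageE:
  fixes f :: "nat \<Rightarrow> 'a::real_vector"
  assumes "v \<in> span (f ` A)" "finite A" "inj_on f A"
  obtains \<alpha> where "v = (\<Sum>i\<in>A. \<alpha> i *\<^sub>R f i)"
proof -
  obtain u where "v = (\<Sum>x\<in>f ` A. u x *\<^sub>R x)"
    using assms(1,2) by (auto simp: span_finite)
  then show thesis using that[of "u \<circ> f"] by (simp add: sum.reindex assms(3))
qed

section \<open>Flat Lie algebras with an adapted basis\<close>

locale adapted_flat_lie_algebra = flat_lie_algebra br
  for br :: "'a::euclidean_space \<Rightarrow> 'a \<Rightarrow> 'a" +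
  fixes k0 :: nat and s :: "nat \<Rightarrow> 'a" and l0 :: nat and z :: "nat \<Rightarrow> 'a"
    and m :: nat and d :: "nat \<Rightarrow> 'a" and lam :: "nat \<Rightarrow> nat \<Rightarrow> real"
  assumes adapted: "adapted_basis br k0 s l0 z m d lam"
begin

lemma s_basis: "inj_on s {1..k0}" "lie_s br = span (s ` {1..k0})"
  and z_basis: "inj_on z {1..l0}" "lie_center br = span (z ` {1..l0})"
  and d_basis: "inj_on d {1..2*m}" "lie_derived br = span (d ` {1..2*m})"
      "independent (d ` {1..2*m})"
  and d_inner: "a \<in> {1..2*m} \<Longrightarrow> b \<in> {1..2*m} \<Longrightarrow> d a \<bullet> d b = (if a = b then 1 else 0)"
  and br_s_d: "k \<in> {1..k0} \<Longrightarrow> i \<in> {1..m} \<Longrightarrow> br (s k) (d (2*i - 1)) = lam k i *\<^sub>R d (2*i)"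
    "k \<in> {1..k0} \<Longrightarrow> i \<in> {1..m} \<Longrightarrow> br (s k) (d (2*i)) = - lam k i *\<^sub>R d (2*i - 1)"
  using adapted by (auto simp: adapted_basis_def indexed_basis_def)

lemma s_mem: "k \<in> {1..k0} \<Longrightarrow> s k \<in> lie_s br"
  and d_mem: "a \<in> {1..2*m} \<Longrightarrow> d a \<in> lie_derived br"
  by (auto simp: s_basis d_basis intro: span_base)

text \<open>
  Otherwise \<open>d\<^sub>2\<^sub>i\<close> would commute with \<open>\<ss>\<close>, hence vanish.
\<close>

lemma weight_nonzero:
  assumes "i \<in> {1..m}"
  shows "\<exists>k\<in>{1..k0}. lam k i \<noteq> 0"
proof (rule ccontr)
  assume "\<not> ?thesis"
  then have 0: "br (s k) (d (2*i)) = 0" if "k \<in> {1..k0}" for k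
    using br_s_d(2)[OF that assms] that by auto
  have "br x (d (2*i)) = 0" if x: "x \<in> lie_s br" for x
  proof -
    obtain \<alpha> where "x = (\<Sum>k=1..k0. \<alpha> k *\<^sub>R s k)"
      using span_imageE[of x s "{1..k0}"] x s_basis by auto
    moreover have l: "linear (\<lambda>x. br x (d (2*i)))" using bilinear_br by (simp add: bilinear_def)
    ultimately show ?thesis using 0 by (simp add: linear_sum[OF l] linear_cmul[OF l])
  qed
  then have "d (2*i) = 0" using assms by (intro derived_faithful[OF d_mem]) auto
  then show False using d_inner[of "2*i" "2*i"] assms by auto
qed

text \<open>
  The orthogonal projections onto \<open>\<dd>\<close> and onto \<open>\<ss> \<oplus> \<zz>\<close>.
\<close>

definition proj_d :: "'a \<Rightarrow> 'a" where
  "proj_d x = (\<Sum>a=1..2*m. (x \<bullet> d a) *\<^sub>R d a)"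

definition proj_sz :: "'a \<Rightarrow> 'a" where
  "proj_sz x = x - proj_d x"

lemma linear_proj_sz: "linear proj_sz"
  unfolding linear_iff proj_sz_def proj_d_def
  by (simp add: inner_simps sum.distrib scaleR_left_distrib scaleR_right.sum algebra_simps)

lemma proj_sz_self_adjoint: "proj_sz x \<bullet> y = x \<bullet> proj_sz y"
  by (simp add: proj_sz_def proj_d_def inner_simps inner_sum_left inner_sum_right
      inner_commute[of _ y] mult.commute)

lemma proj_sz_orthogonal_d:
  assumes "a \<in> {1..2*m}"
  shows "proj_sz x \<bullet> d a = 0"
proof -
  have "proj_d x \<bullet> d a = (\<Sum>b=1..2*m. if b = a then x \<bullet> d b else 0)"
    unfolding proj_d_def inner_sum_left by (rule sum.cong) (use assms d_inner in auto)
  then show ?thesis using assms by (simp add: proj_sz_def inner_simps)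
qed

lemma proj_sz_decomp:
  obtains y w where "proj_sz x = y + w" "y \<in> lie_center br" "w \<in> lie_s br"
proof -
  let ?p = "proj_sz x" and ?W = "lie_center br \<union> lie_derived br"
  have perp: "?p \<bullet> v = 0" if "v \<in> lie_derived br" for v
  proof -
    have "span (d ` {1..2*m}) \<subseteq> {v. ?p \<bullet> v = 0}"
      by (intro span_minimal subspace_hyperplane) (auto simp: proj_sz_orthogonal_d)
    then show ?thesis using that d_basis by blast
  qed
  obtain y w where yw: "y \<in> span ?W" "\<And>u. u \<in> span ?W \<Longrightarrow> orthogonal w u" "?p = y + w"
    using orthogonal_subspace_decomp_exists[of ?W ?p] by blast
  have sub: "span (lie_center br) = lie_center br" "span (lie_derived br) = lie_derived br"
    by (simp_all add: z_basis d_basis)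
  obtain y1 y2 where y: "y = y1 + y2" "y1 \<in> lie_center br" "y2 \<in> lie_derived br"
    using yw(1) unfolding span_Un sub by auto
  have "w \<in> lie_s br"
    using yw(2) by (auto simp: lie_s_def orthogonal_comp_def orthogonal_commute)
  moreover have "y2 \<bullet> y2 = 0"
  proof -
    have "w \<bullet> y2 = 0" using yw(2)[of y2] y by (simp add: orthogonal_def span_base)
    then show ?thesis
      using perp[OF y(3)] center_orthogonal_derived[OF y(2,3)] by (simp add: yw(3) y(1) inner_simps)
  qed
  ultimately show thesis using that[of y1 w] y yw(3) by simp
qed

lemma br_lie_s_proj_sz:
  assumes x: "x \<in> lie_s br"
  shows "br x (proj_sz y) = 0"
proof -
  obtain c w where "proj_sz y = c + w" "c \<in> lie_center br" "w \<in> lie_s br"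
    by (rule proj_sz_decomp)
  moreover from this have "br x c = 0" using br_anti[of c x] by (simp add: lie_center_def)
  ultimately show ?thesis using lie_s_abelian[OF x] by (simp add: br_simps)
qed

lemma pair_index: "a \<in> {1..2*m} \<Longrightarrow> \<exists>i\<in>{1..m}. a = 2*i - 1 \<or> a = 2*i"
  by (intro bexI[of _ "(a + 1) div 2"]) auto

lemma proj_sum: "x = proj_sz x + proj_d x"
  by (simp add: proj_sz_def)

text \<open>
  The part of a bivector that invariance leaves unrestricted.
\<close>

definition sz_sum ::
  "(nat \<Rightarrow> nat \<Rightarrow> real) \<Rightarrow> (nat \<Rightarrow> nat \<Rightarrow> real) \<Rightarrow> (nat \<Rightarrow> nat \<Rightarrow> real) \<Rightarrow> 'a bivector" where
  "sz_sum a b f = (\<Sum>i=1..k0. \<Sum>j\<in>{i<..k0}. a i j *\<^sub>R wedge (s i) (s j))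
    + (\<Sum>i=1..k0. \<Sum>j=1..l0. b i j *\<^sub>R wedge (s i) (z j))
    + (\<Sum>i=1..l0. \<Sum>j\<in>{i<..l0}. f i j *\<^sub>R wedge (z i) (z j))"

definition sz_bivectors :: "'a bivector set" where
  "sz_bivectors = {sz_sum a b f |a b f. True}"

lemma subspace_sz_bivectors: "subspace sz_bivectors"
proof (rule subspaceI)
  have "sz_sum (\<lambda>_ _. 0) (\<lambda>_ _. 0) (\<lambda>_ _. 0) = 0" by (simp add: sz_sum_def)
  then show "0 \<in> sz_bivectors" unfolding sz_bivectors_def by (metis (mono_tags) mem_Collect_eq)
next
  fix x y assume "x \<in> sz_bivectors" "y \<in> sz_bivectors"
  then obtain a b f a' b' f' where "x = sz_sum a b f" "y = sz_sum a' b' f'"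
    unfolding sz_bivectors_def by blast
  then have "x + y = sz_sum (\<lambda>i j. a i j + a' i j) (\<lambda>i j. b i j + b' i j) (\<lambda>i j. f i j + f' i j)"
    by (simp add: sz_sum_def scaleR_left_distrib sum.distrib)
  then show "x + y \<in> sz_bivectors" unfolding sz_bivectors_def by blast
next
  fix c x assume "x \<in> sz_bivectors"
  then obtain a b f where "x = sz_sum a b f"
    unfolding sz_bivectors_def by blast
  then have "c *\<^sub>R x = sz_sum (\<lambda>i j. c * a i j) (\<lambda>i j. c * b i j) (\<lambda>i j. c * f i j)"
    by (simp add: sz_sum_def scaleR_right_distrib scaleR_right.sum)
  then show "c *\<^sub>R x \<in> sz_bivectors" unfolding sz_bivectors_def by blast
qed

lemma proj_sz_expansion:
  obtains \<alpha> \<beta> where "proj_sz x = (\<Sum>i=1..k0. \<alpha> i *\<^sub>R s i) + (\<Sum>i=1..l0. \<beta> i *\<^sub>R z i)"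
proof -
  obtain c w where cw: "proj_sz x = c + w" "c \<in> lie_center br" "w \<in> lie_s br"
    by (rule proj_sz_decomp)
  obtain \<alpha> where "w = (\<Sum>i=1..k0. \<alpha> i *\<^sub>R s i)"
    using span_imageE[of w s "{1..k0}"] cw s_basis by auto
  moreover obtain \<beta> where "c = (\<Sum>i=1..l0. \<beta> i *\<^sub>R z i)"
    using span_imageE[of c z "{1..l0}"] cw z_basis by auto
  ultimately show thesis using that cw(1) by (simp add: add.commute)
qed

lemma wedge_proj_sz: "wedge (proj_sz x) (proj_sz y) \<in> sz_bivectors"
proof -
  obtain \<alpha> \<beta> where x: "proj_sz x = (\<Sum>i=1..k0. \<alpha> i *\<^sub>R s i) + (\<Sum>i=1..l0. \<beta> i *\<^sub>R z i)"
    by (rule proj_sz_expansion)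
  obtain \<gamma> \<delta> where y: "proj_sz y = (\<Sum>i=1..k0. \<gamma> i *\<^sub>R s i) + (\<Sum>i=1..l0. \<delta> i *\<^sub>R z i)"
    by (rule proj_sz_expansion)
  have "wedge (proj_sz x) (proj_sz y)
    = (\<Sum>i=1..k0. \<Sum>j\<in>{i<..k0}. (\<alpha> i * \<gamma> j - \<alpha> j * \<gamma> i) *\<^sub>R wedge (s i) (s j))
      + ((\<Sum>i=1..k0. \<Sum>j=1..l0. (\<alpha> i * \<delta> j) *\<^sub>R wedge (s i) (z j))
        - (\<Sum>i=1..k0. \<Sum>j=1..l0. (\<gamma> i * \<beta> j) *\<^sub>R wedge (s i) (z j)))
      + (\<Sum>i=1..l0. \<Sum>j\<in>{i<..l0}. (\<beta> i * \<delta> j - \<beta> j * \<delta> i) *\<^sub>R wedge (z i) (z j))"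
    unfolding x y wedge_simps wedge_sum_triangle
      wedge_anti[of "\<Sum>i=1..l0. \<beta> i *\<^sub>R z i" "\<Sum>i=1..k0. \<gamma> i *\<^sub>R s i"]
    unfolding wedge_sum_sum by simp
  also have "(\<Sum>i=1..k0. \<Sum>j=1..l0. (\<alpha> i * \<delta> j) *\<^sub>R wedge (s i) (z j))
        - (\<Sum>i=1..k0. \<Sum>j=1..l0. (\<gamma> i * \<beta> j) *\<^sub>R wedge (s i) (z j))
      = (\<Sum>i=1..k0. \<Sum>j=1..l0. (\<alpha> i * \<delta> j - \<gamma> i * \<beta> j) *\<^sub>R wedge (s i) (z j))"
    by (simp add: scaleR_left_diff_distrib sum_subtractf)
  finally have "wedge (proj_sz x) (proj_sz y) = sz_sum (\<lambda>i j. \<alpha> i * \<gamma> j - \<alpha> j * \<gamma> i)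
      (\<lambda>i j. \<alpha> i * \<delta> j - \<gamma> i * \<beta> j) (\<lambda>i j. \<beta> i * \<delta> j - \<beta> j * \<delta> i)"
    by (simp only: sz_sum_def)
  then show ?thesis unfolding sz_bivectors_def by blast
qed

end

section \<open>Invariant bivectors\<close>

locale invariant_bivector = adapted_flat_lie_algebra +
  fixes r
  assumes invariant: "x \<in> lie_s br \<Longrightarrow> ad2 br x r = 0"
begin

abbreviation R :: "nat \<Rightarrow> nat \<Rightarrow> real" where
  "R a b \<equiv> bivector_coeff r (d a) (d b)"

lemma coeff_invariant:
  "x \<in> lie_s br \<Longrightarrow> bivector_coeff r (br x u) v + bivector_coeff r u (br x v) = 0"
  using bivector_coeff_ad2[of x r u v] invariant[of x] by (simp add: linear_0[OF linear_bivector_coeff])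

text \<open>
  For \<open>u\<close> in \<open>\<ss> \<oplus> \<zz>\<close> invariance reduces to \<open>r (u, ad\<^sub>x v) = 0\<close> for \<open>x\<close> in \<open>\<ss>\<close>, and some \<open>s\<^sub>k\<close>
  rotates the \<open>i\<close>-th plane of \<open>\<dd>\<close> with nonzero speed.
\<close>

lemma coeff_proj_sz_d:
  assumes "a \<in> {1..2*m}"
  shows "bivector_coeff r (proj_sz u) (d a) = 0"
proof -
  obtain i where i: "i \<in> {1..m}" "a = 2*i - 1 \<or> a = 2*i" using pair_index[OF assms] by blast
  obtain k where k: "k \<in> {1..k0}" "lam k i \<noteq> 0" using weight_nonzero[OF i(1)] by blast
  have "bivector_coeff r (proj_sz u) (br (s k) v) = 0" for v
    using coeff_invariant[OF s_mem[OF k(1)], of "proj_sz u" v]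
    by (simp add: br_lie_s_proj_sz[OF s_mem[OF k(1)]] bivector_coeff_simps)
  from this[of "d (2*i - 1)"] this[of "d (2*i)"] show ?thesis
    using i k unfolding br_s_d[OF k(1) i(1)] bivector_coeff_simps by auto
qed

lemma coeff_proj_sz_proj_d: "bivector_coeff r (proj_sz u) (proj_d v) = 0"
  unfolding proj_d_def
  by (simp add: linear_sum[OF linear_bivector_coeff_right] bivector_coeff_simps coeff_proj_sz_d)

lemma coeff_proj_d: "bivector_coeff r (proj_d u) (proj_d v)
    = (\<Sum>a=1..2*m. \<Sum>b=1..2*m. R a b * ((u \<bullet> d a) * (v \<bullet> d b)))"
  unfolding proj_d_def
  by (simp add: linear_sum[OF linear_bivector_coeff_right] linear_sum[OF linear_bivector_coeff_left]
      bivector_coeff_simps sum_distrib_left ac_simps)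
     (rule sum.swap)

text \<open>
  Both components of \<open>r\<close> are images under the exterior squares of the two projections; invariance
  rules out the mixed terms.
\<close>

lemma sz_d_decomposition:
  obtains t where "t \<in> sz_bivectors"
    "r = t + (\<Sum>a=1..2*m. \<Sum>b=1..2*m. (R a b / 2) *\<^sub>R wedge (d a) (d b))"
proof -
  define t where "t = (\<Sum>b\<in>Basis. \<Sum>c\<in>Basis.
    (bivector_coeff r b c / 2) *\<^sub>R wedge (proj_sz b) (proj_sz c))"
  let ?D = "\<Sum>a=1..2*m. \<Sum>b=1..2*m. (R a b / 2) *\<^sub>R wedge (d a) (d b)"
  have "r = t + ?D"
  proof (rule bivector_eqI)
    fix u v
    have "bivector_coeff ?D u v = (\<Sum>a=1..2*m. \<Sum>b=1..2*m. R a b / 2 * ((u \<bullet> d a) * (v \<bullet> d b)))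
        - (\<Sum>a=1..2*m. \<Sum>b=1..2*m. R a b / 2 * ((u \<bullet> d b) * (v \<bullet> d a)))"
      by (simp add: linear_sum[OF linear_bivector_coeff] linear_cmul[OF linear_bivector_coeff]
          bivector_coeff_wedge right_diff_distrib sum_subtractf inner_commute)
    also have "(\<Sum>a=1..2*m. \<Sum>b=1..2*m. R a b / 2 * ((u \<bullet> d b) * (v \<bullet> d a)))
        = (\<Sum>a=1..2*m. \<Sum>b=1..2*m. R b a / 2 * ((u \<bullet> d a) * (v \<bullet> d b)))"
      by (rule sum.swap)
    also have "\<dots> = - (\<Sum>a=1..2*m. \<Sum>b=1..2*m. R a b / 2 * ((u \<bullet> d a) * (v \<bullet> d b)))"
      unfolding sum_negf[symmetric]
      by (intro sum.cong refl) (subst bivector_coeff_anti, simp)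
    finally have D: "bivector_coeff ?D u v = bivector_coeff r (proj_d u) (proj_d v)"
      unfolding coeff_proj_d by (simp flip: sum_divide_distrib add: sum_distrib_left)
    have "bivector_coeff t u v = bivector_coeff r (proj_sz u) (proj_sz v)"
      unfolding t_def
      by (rule bivector_coeff_pushforward[OF linear_proj_sz linear_proj_sz proj_sz_self_adjoint])
    moreover have "bivector_coeff r u v
        = bivector_coeff r (proj_sz u) (proj_sz v) + bivector_coeff r (proj_d u) (proj_d v)"
      using coeff_proj_sz_proj_d[of u v] coeff_proj_sz_proj_d[of v u]
        bivector_coeff_anti[of r "proj_sz v" "proj_d u"]
      by (subst proj_sum[of u], subst proj_sum[of v]) (simp add: bivector_coeff_simps)
    ultimately show "bivector_coeff r u v = bivector_coeff (t + ?D) u v"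
      using D by (simp add: linear_add[OF linear_bivector_coeff])
  qed
  moreover have "t \<in> sz_bivectors"
    unfolding t_def
    by (intro subspace_sum[OF subspace_sz_bivectors] subspace_scale[OF subspace_sz_bivectors]
        wedge_proj_sz)
  ultimately show thesis using that by blast
qed

text \<open>
  Of the four families of products of an odd or even index with another, the two mixed ones agree up
  to order; each pure one is symmetric, so half of the full sum is the sum over \<open>i < j\<close>.
\<close>

lemma d_part:
  "(\<Sum>a=1..2*m. \<Sum>b=1..2*m. (R a b / 2) *\<^sub>R wedge (d a) (d b))
    = (\<Sum>i=1..m. \<Sum>j\<in>{i<..m}. R (2*i - 1) (2*j - 1) *\<^sub>R wedge (d (2*i - 1)) (d (2*j - 1)))
      + (\<Sum>i=1..m. \<Sum>j=1..m. R (2*i - 1) (2*j) *\<^sub>R wedge (d (2*i - 1)) (d (2*j)))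
      + (\<Sum>i=1..m. \<Sum>j\<in>{i<..m}. R (2*i) (2*j) *\<^sub>R wedge (d (2*i)) (d (2*j)))"
proof -
  define h where "h a b = (R a b / 2) *\<^sub>R wedge (d a) (d b)" for a b
  have sym: "h a b = h b a" for a b
    using bivector_coeff_anti[of r "d b" "d a"] wedge_anti[of "d b" "d a"] by (simp add: h_def)
  have diag: "h a a = 0" for a by (simp add: h_def)
  have double: "h a b + h a b = R a b *\<^sub>R wedge (d a) (d b)" for a b
    unfolding h_def by (simp flip: scaleR_left_distrib)
  have tri: "(\<Sum>i=1..m. \<Sum>j=1..m. h (g i) (g j))
      = (\<Sum>i=1..m. \<Sum>j\<in>{i<..m}. R (g i) (g j) *\<^sub>R wedge (d (g i)) (d (g j)))" for g
    unfolding sum_square_triangle[where h = "\<lambda>i j. h (g i) (g j)", OF diag]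
    by (intro sum.cong refl) (simp add: sym[of "g j" "g i" for i j] flip: double)
  have "(\<Sum>a=1..2*m. \<Sum>b=1..2*m. h a b)
    = (\<Sum>i=1..m. \<Sum>j=1..m. h (2*i - 1) (2*j - 1))
      + ((\<Sum>i=1..m. \<Sum>j=1..m. h (2*i - 1) (2*j)) + (\<Sum>i=1..m. \<Sum>j=1..m. h (2*i) (2*j - 1)))
      + (\<Sum>i=1..m. \<Sum>j=1..m. h (2*i) (2*j))"
    unfolding sum_pairs by (simp add: sum.distrib ac_simps)
  also have "(\<Sum>i=1..m. \<Sum>j=1..m. h (2*i) (2*j - 1)) = (\<Sum>i=1..m. \<Sum>j=1..m. h (2*i - 1) (2*j))"
    by (subst sum.swap) (intro sum.cong refl sym)
  also have "(\<Sum>i=1..m. \<Sum>j=1..m. h (2*i - 1) (2*j)) + (\<Sum>i=1..m. \<Sum>j=1..m. h (2*i - 1) (2*j))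
      = (\<Sum>i=1..m. \<Sum>j=1..m. R (2*i - 1) (2*j) *\<^sub>R wedge (d (2*i - 1)) (d (2*j)))"
    by (simp flip: sum.distrib add: double)
  finally show ?thesis unfolding tri by (simp only: h_def)
qed

text \<open>
  Invariance of \<open>r\<close> under \<open>s\<^sub>k\<close>, evaluated on the four pairs of basis vectors of the planes \<open>i\<close>
  and \<open>j\<close>.
\<close>

lemma block_equations:
  assumes k: "k \<in> {1..k0}" and i: "i \<in> {1..m}" and j: "j \<in> {1..m}"
  shows "lam k i * R (2*i) (2*j - 1) + lam k j * R (2*i - 1) (2*j) = 0"
    "lam k i * R (2*i - 1) (2*j) + lam k j * R (2*i) (2*j - 1) = 0"
    "lam k i * R (2*i) (2*j) = lam k j * R (2*i - 1) (2*j - 1)"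
    "lam k i * R (2*i - 1) (2*j - 1) = lam k j * R (2*i) (2*j)"
  using coeff_invariant[OF s_mem[OF k], of "d (2*i - 1)" "d (2*j - 1)"]
    coeff_invariant[OF s_mem[OF k], of "d (2*i)" "d (2*j)"]
    coeff_invariant[OF s_mem[OF k], of "d (2*i - 1)" "d (2*j)"]
    coeff_invariant[OF s_mem[OF k], of "d (2*i)" "d (2*j - 1)"]
  unfolding br_s_d[OF k i] br_s_d[OF k j] bivector_coeff_simps by simp_all

lemma block_sign:
  assumes i: "i \<in> {1..m}" and j: "j \<in> {1..m}" and e: "e \<in> {-1, 1}"
    and lam: "\<forall>k\<in>{1..k0}. lam k j = e * lam k i"
  shows "R (2*i) (2*j) = e * R (2*i - 1) (2*j - 1)" "R (2*i) (2*j - 1) = - e * R (2*i - 1) (2*j)"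
proof -
  obtain k where k: "k \<in> {1..k0}" "lam k i \<noteq> 0" using weight_nonzero[OF i] by blast
  have "lam k i * R (2*i) (2*j) = lam k i * (e * R (2*i - 1) (2*j - 1))"
    "lam k i * R (2*i) (2*j - 1) = lam k i * (- e * R (2*i - 1) (2*j))"
    using block_equations(1,3)[OF k(1) i j] lam k(1) by (simp_all add: algebra_simps)
  then show "R (2*i) (2*j) = e * R (2*i - 1) (2*j - 1)"
    "R (2*i) (2*j - 1) = - e * R (2*i - 1) (2*j)"
    unfolding mult_left_cancel[OF k(2)] by simp_all
qed

text \<open>
  The sums and differences of the block equations have the factors \<open>\<lambda>\<^sub>i - \<lambda>\<^sub>j\<close> and
  \<open>\<lambda>\<^sub>i + \<lambda>\<^sub>j\<close>.  Each factor is nonzero at some element of the basis of \<open>\<ss>\<close>, though not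
  necessarily at the same one: \<open>\<lambda>\<^sub>i\<^sup>2 = \<lambda>\<^sub>j\<^sup>2\<close> may hold at every basis element without
  \<open>\<lambda>\<^sub>j = \<plusminus>\<lambda>\<^sub>i\<close>.
\<close>

lemma block_zero:
  assumes i: "i \<in> {1..m}" and j: "j \<in> {1..m}"
    and lam: "\<not> (\<exists>e\<in>{-1, 1}. \<forall>k\<in>{1..k0}. lam k j = e * lam k i)"
  shows "R (2*i - 1) (2*j - 1) = 0" "R (2*i - 1) (2*j) = 0" "R (2*i) (2*j - 1) = 0"
    "R (2*i) (2*j) = 0"
proof -
  obtain k where k: "k \<in> {1..k0}" "lam k i - lam k j \<noteq> 0" using lam by auto
  obtain l where l: "l \<in> {1..k0}" "lam l i + lam l j \<noteq> 0" using lam by auto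
  have "(lam k i - lam k j) * (R (2*i) (2*j) + R (2*i - 1) (2*j - 1)) = 0"
    "(lam k i - lam k j) * (R (2*i) (2*j - 1) - R (2*i - 1) (2*j)) = 0"
    using block_equations[OF k(1) i j] by (simp_all add: algebra_simps)
  moreover have "(lam l i + lam l j) * (R (2*i) (2*j) - R (2*i - 1) (2*j - 1)) = 0"
    "(lam l i + lam l j) * (R (2*i) (2*j - 1) + R (2*i - 1) (2*j)) = 0"
    using block_equations[OF l(1) i j] by (simp_all add: algebra_simps)
  ultimately show "R (2*i - 1) (2*j - 1) = 0" "R (2*i - 1) (2*j) = 0" "R (2*i) (2*j - 1) = 0"
    "R (2*i) (2*j) = 0"
    using k(2) l(2) unfolding mult_eq_0_iff by linarith+
qed

end

section \<open>Weights of a nondegenerate flat Lie algebra\<close>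

context adapted_flat_lie_algebra
begin

text \<open>
  Here \<open>\<mu>\<close> is \<open>\<lambda>\<^sub>i(x)\<close>.  Weights that agree up to sign thus give the same eigenvalue of
  \<open>ad\<^sub>x ad\<^sub>x\<close> for every \<open>x\<close> in \<open>\<ss>\<close>, in particular for the members of another adapted basis.
\<close>

lemma weight_square:
  assumes i: "i \<in> {1..m}" and x: "x \<in> lie_s br"
  shows "\<exists>\<mu>. \<forall>j\<in>{1..m}. \<forall>e. (\<forall>k\<in>{1..k0}. lam k j = e * lam k i) \<longrightarrow>
    br x (br x (d (2*j - 1))) = - (e * \<mu>)\<^sup>2 *\<^sub>R d (2*j - 1) \<and>
    br x (br x (d (2*j))) = - (e * \<mu>)\<^sup>2 *\<^sub>R d (2*j)"
proof -
  obtain \<alpha> where \<alpha>: "x = (\<Sum>k=1..k0. \<alpha> k *\<^sub>R s k)"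
    using span_imageE[of x s "{1..k0}"] x s_basis by auto
  have l: "linear (\<lambda>x. br x v)" for v using bilinear_br by (simp add: bilinear_def)
  define \<mu> where "\<mu> = (\<Sum>k=1..k0. \<alpha> k * lam k i)"
  have rot: "br x (d (2*j - 1)) = (e * \<mu>) *\<^sub>R d (2*j)"
    "br x (d (2*j)) = - (e * \<mu>) *\<^sub>R d (2*j - 1)"
    if j: "j \<in> {1..m}" and e: "\<forall>k\<in>{1..k0}. lam k j = e * lam k i" for j e
  proof -
    have "e * \<mu> = (\<Sum>k=1..k0. \<alpha> k * lam k j)"
      using e by (simp add: \<mu>_def sum_distrib_left ac_simps)
    then show "br x (d (2*j - 1)) = (e * \<mu>) *\<^sub>R d (2*j)"
      "br x (d (2*j)) = - (e * \<mu>) *\<^sub>R d (2*j - 1)"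
      unfolding \<alpha> linear_sum[OF l] linear_cmul[OF l]
      using br_s_d[OF _ j] by (simp_all add: scaleR_left.sum sum_negf)
  qed
  have "br x (br x (d (2*j - 1))) = - (e * \<mu>)\<^sup>2 *\<^sub>R d (2*j - 1) \<and>
      br x (br x (d (2*j))) = - (e * \<mu>)\<^sup>2 *\<^sub>R d (2*j)"
    if "j \<in> {1..m}" "\<forall>k\<in>{1..k0}. lam k j = e * lam k i" for j e
    unfolding rot[OF that] br_simps by (simp add: power2_eq_square)
  then show ?thesis by blast
qed

text \<open>
  If the planes \<open>i\<close> and \<open>j\<close> had weights equal up to sign, the set \<open>W\<close> of their four basis vectors
  would consist of joint eigenvectors of all \<open>ad\<^sub>x ad\<^sub>x\<close> with common eigenvalues.  Expanded in an
  adapted basis with pairwise distinct squared weights, such vectors have components in a single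
  plane only, which has no room for four independent vectors.
\<close>

lemma weights_distinct:
  assumes nondeg: "nondegenerate br" and ij: "i \<in> {1..m}" "j \<in> {1..m}" "i \<noteq> j"
    and e: "e \<in> {-1, 1}"
  shows "\<not> (\<forall>k\<in>{1..k0}. lam k j = e * lam k i)"
proof
  assume lam_e: "\<forall>k\<in>{1..k0}. lam k j = e * lam k i"
  obtain k0' s' l0' z' m' d' lam' where ad: "adapted_basis br k0' s' l0' z' m' d' lam'"
    and sep: "\<forall>i\<in>{1..m'}. \<forall>j\<in>{1..m'}. i \<noteq> j \<longrightarrow> (\<exists>k\<in>{1..k0'}. (lam' k j)\<^sup>2 \<noteq> (lam' k i)\<^sup>2)"
    using nondeg unfolding nondegenerate_def by blast
  interpret o: adapted_flat_lie_algebra br k0' s' l0' z' m' d' lam'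
    by unfold_locales (rule ad)
  have I: "{2*i - 1, 2*i, 2*j - 1, 2*j} \<subseteq> {1..2*m}" using ij by auto
  define W where "W = d ` {2*i - 1, 2*i, 2*j - 1, 2*j}"
  have common: "\<exists>c. \<forall>w\<in>W. br x (br x w) = c *\<^sub>R w" if x: "x \<in> lie_s br" for x
  proof -
    obtain \<mu> where \<mu>: "\<forall>j\<in>{1..m}. \<forall>e. (\<forall>k\<in>{1..k0}. lam k j = e * lam k i) \<longrightarrow>
      br x (br x (d (2*j - 1))) = - (e * \<mu>)\<^sup>2 *\<^sub>R d (2*j - 1) \<and>
      br x (br x (d (2*j))) = - (e * \<mu>)\<^sup>2 *\<^sub>R d (2*j)"
      using weight_square[OF ij(1) x] by blast
    have "br x (br x (d (2*i - 1))) = - \<mu>\<^sup>2 *\<^sub>R d (2*i - 1)" "br x (br x (d (2*i))) = - \<mu>\<^sup>2 *\<^sub>R d (2*i)"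
      using \<mu>[rule_format, OF ij(1), of 1] by simp_all
    moreover have "br x (br x (d (2*j - 1))) = - \<mu>\<^sup>2 *\<^sub>R d (2*j - 1)"
      "br x (br x (d (2*j))) = - \<mu>\<^sup>2 *\<^sub>R d (2*j)"
      using \<mu>[rule_format, OF ij(2), of e] lam_e e by (auto simp: power_mult_distrib)
    ultimately show ?thesis unfolding W_def by (intro exI[of _ "- \<mu>\<^sup>2"]) blast
  qed
  obtain c where c: "\<And>k w. k \<in> {1..k0'} \<Longrightarrow> w \<in> W \<Longrightarrow> br (s' k) (br (s' k) w) = c k *\<^sub>R w"
    using common[OF o.s_mem] by metis
  \<comment> \<open>\<open>ad\<^sub>x ad\<^sub>x\<close> is symmetric, so eigenvectors that are not orthogonal share the eigenvalue.\<close>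
  have sq: "c k = - (lam' k l)\<^sup>2"
    if "k \<in> {1..k0'}" "l \<in> {1..m'}" "w \<in> W" "a = 2*l - 1 \<or> a = 2*l" "w \<bullet> d' a \<noteq> 0" for k l w a
  proof -
    have "br (s' k) (br (s' k) (d' (2*l - 1))) = - (lam' k l)\<^sup>2 *\<^sub>R d' (2*l - 1)"
      "br (s' k) (br (s' k) (d' (2*l))) = - (lam' k l)\<^sup>2 *\<^sub>R d' (2*l)"
      unfolding o.br_s_d[OF that(1,2)] br_simps by (simp_all add: power2_eq_square)
    with that(4) have "br (s' k) (br (s' k) (d' a)) = - (lam' k l)\<^sup>2 *\<^sub>R d' a"
      by (elim disjE; simp only:)
    moreover have "br (s' k) (br (s' k) w) \<bullet> d' a = w \<bullet> br (s' k) (br (s' k) (d' a))"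
      using br_lie_s_skew[OF o.s_mem[OF that(1)]] by simp
    ultimately show ?thesis
      using c[OF that(1,3)] mult_right_cancel[OF that(5), of "c k" "- (lam' k l)\<^sup>2"] by simp
  qed
  have W_derived: "W \<subseteq> lie_derived br"
    using ij by (auto simp: W_def intro!: d_mem)
  have exp: "w = (\<Sum>a=1..2*m'. (w \<bullet> d' a) *\<^sub>R d' a)" if w: "w \<in> lie_derived br" for w
  proof -
    obtain \<beta> where \<beta>: "w = (\<Sum>a=1..2*m'. \<beta> a *\<^sub>R d' a)"
      using span_imageE[of w d' "{1..2*m'}"] w o.d_basis by auto
    have "w \<bullet> d' a = \<beta> a" if "a \<in> {1..2*m'}" for a
    proof -
      have "w \<bullet> d' a = (\<Sum>b=1..2*m'. if b = a then \<beta> b else 0)"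
        unfolding \<beta> inner_sum_left by (rule sum.cong) (use that o.d_inner in auto)
      then show ?thesis using that by simp
    qed
    then show ?thesis using \<beta> by simp
  qed
  have "d (2*i) \<noteq> 0" using d_inner[of "2*i" "2*i"] ij by auto
  have "\<exists>a\<in>{1..2*m'}. d (2*i) \<bullet> d' a \<noteq> 0"
  proof (rule ccontr)
    assume "\<not> ?thesis"
    then show False using exp[of "d (2*i)"] W_derived \<open>d (2*i) \<noteq> 0\<close> by (simp add: W_def)
  qed
  then obtain l where l: "l \<in> {1..m'}" and "\<exists>a. (a = 2*l - 1 \<or> a = 2*l) \<and> d (2*i) \<bullet> d' a \<noteq> 0"
    using o.pair_index by metis
  then have cl: "c k = - (lam' k l)\<^sup>2" if "k \<in> {1..k0'}" for k
    using sq[OF that l, of "d (2*i)"] by (auto simp: W_def)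
  have "W \<subseteq> span {d' (2*l - 1), d' (2*l)}"
  proof
    fix w assume w: "w \<in> W"
    have "(w \<bullet> d' a) *\<^sub>R d' a \<in> span {d' (2*l - 1), d' (2*l)}" if a: "a \<in> {1..2*m'}" for a
    proof (cases "w \<bullet> d' a = 0")
      case False
      obtain l' where l': "l' \<in> {1..m'}" "a = 2*l' - 1 \<or> a = 2*l'"
        using o.pair_index[OF a] by blast
      have "(lam' k l')\<^sup>2 = (lam' k l)\<^sup>2" if "k \<in> {1..k0'}" for k
        using sq[OF that l'(1) w l'(2) False] cl[OF that] by simp
      then have "l' = l" using sep l l'(1) by metis
      then show ?thesis using l'(2) by (auto intro: span_scale span_base)
    qed (simp add: span_zero)
    then have "(\<Sum>a=1..2*m'. (w \<bullet> d' a) *\<^sub>R d' a) \<in> span {d' (2*l - 1), d' (2*l)}"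
      by (rule span_sum)
    then show "w \<in> span {d' (2*l - 1), d' (2*l)}" using exp[of w] w W_derived by auto
  qed
  moreover have "independent W"
    unfolding W_def by (rule independent_mono[OF d_basis(3) image_mono[OF I]])
  ultimately have "card W \<le> card {d' (2*l - 1), d' (2*l)}"
    using independent_span_bound[of "{d' (2*l - 1), d' (2*l)}" W] by simp
  also have "\<dots> \<le> 2" by (simp add: card_insert_if)
  finally have "card W \<le> 2" .
  moreover have "card W = card {2*i - 1, 2*i, 2*j - 1, 2*j}"
    unfolding W_def by (rule card_image[OF inj_on_subset[OF d_basis(1) I]])
  moreover have "card {2*i - 1, 2*i, 2*j - 1, 2*j} = 4"
  proof -
    have "2*i - 1 \<noteq> 2*j \<and> 2*i \<noteq> 2*j - 1 \<and> 2*i - 1 \<noteq> 2*i \<and> 2*j - 1 \<noteq> 2*j \<and> 2*i - 1 \<noteq> 2*j - 1"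
      using ij unfolding atLeastAtMost_iff by presburger
    then show ?thesis using ij(3) by simp
  qed
  ultimately show False by simp
qed

end

section \<open>Coboundaries of metaflat Lie algebras\<close>

theorem proposition3p2:
  fixes br :: "'a::euclidean_space \<Rightarrow> 'a \<Rightarrow> 'a"
    and k0 l0 m :: nat
    and s z d :: "nat \<Rightarrow> 'a"
    and lam :: "nat \<Rightarrow> nat \<Rightarrow> real"
    and r :: "'a bivector"
  assumes flat: "flat_lie_algebra br"
    and noncommutative: "\<exists>x y. br x y \<noteq> 0"
    and adapted: "adapted_basis br k0 s l0 z m d lam"
    and metaflat: "metaflat br (\<lambda>x. ad2 br x r)"
  shows "(nondegenerate br \<longrightarrow>
      (\<exists>(a :: nat \<Rightarrow> nat \<Rightarrow> real) (b :: nat \<Rightarrow> nat \<Rightarrow> real) (f :: nat \<Rightarrow> nat \<Rightarrow> real)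
          (n :: nat \<Rightarrow> nat \<Rightarrow> real).
        r = (\<Sum>i=1..k0. \<Sum>j\<in>{i<..k0}. a i j *\<^sub>R wedge (s i) (s j))
          + (\<Sum>i=1..k0. \<Sum>j=1..l0. b i j *\<^sub>R wedge (s i) (z j))
          + (\<Sum>i=1..l0. \<Sum>j\<in>{i<..l0}. f i j *\<^sub>R wedge (z i) (z j))
          + (\<Sum>i=1..m. n i i *\<^sub>R wedge (d (2*i - 1)) (d (2*i)))))
    \<and> (degenerate br \<longrightarrow>
      (\<exists>(a :: nat \<Rightarrow> nat \<Rightarrow> real) (b :: nat \<Rightarrow> nat \<Rightarrow> real) (f :: nat \<Rightarrow> nat \<Rightarrow> real)
          (mm :: nat \<Rightarrow> nat \<Rightarrow> real) (n :: nat \<Rightarrow> nat \<Rightarrow> real) (p :: nat \<Rightarrow> nat \<Rightarrow> real)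
          (\<epsilon> :: nat \<Rightarrow> nat \<Rightarrow> real).
        r = (\<Sum>i=1..k0. \<Sum>j\<in>{i<..k0}. a i j *\<^sub>R wedge (s i) (s j))
          + (\<Sum>i=1..k0. \<Sum>j=1..l0. b i j *\<^sub>R wedge (s i) (z j))
          + (\<Sum>i=1..l0. \<Sum>j\<in>{i<..l0}. f i j *\<^sub>R wedge (z i) (z j))
          + (\<Sum>i=1..m. \<Sum>j\<in>{i<..m}. mm i j *\<^sub>R wedge (d (2*i - 1)) (d (2*j - 1)))
          + (\<Sum>i=1..m. \<Sum>j=1..m. n i j *\<^sub>R wedge (d (2*i - 1)) (d (2*j)))
          + (\<Sum>i=1..m. \<Sum>j\<in>{i<..m}. p i j *\<^sub>R wedge (d (2*i)) (d (2*j)))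
        \<and> (\<forall>i j. 1 \<le> i \<and> i < j \<and> j \<le> m \<longrightarrow>
            \<epsilon> i j \<in> {-1, 1} \<and> p i j = \<epsilon> i j * mm i j \<and> n j i = \<epsilon> i j * n i j \<and>
            (\<forall>e\<in>{-1, 1}. (\<forall>k\<in>{1..k0}. lam k j = e * lam k i) \<longrightarrow> \<epsilon> i j = e))))"
proof -
  interpret flat_lie_algebra br by (rule flat)
  interpret adapted_flat_lie_algebra br k0 s l0 z m d lam
    by unfold_locales (rule adapted)
  \<comment> \<open>The metaflat condition at \<open>(x, x, x)\<close> is the vanishing of the third power.\<close>
  interpret invariant_bivector br k0 s l0 z m d lam r
    by unfold_locales (rule ad2_power_kernel, assumption, rule metaflat.metaflat_cond[OF metaflat])
  obtain t where t: "t \<in> sz_bivectors"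
    and r: "r = t + (\<Sum>a=1..2*m. \<Sum>b=1..2*m. (R a b / 2) *\<^sub>R wedge (d a) (d b))"
    by (rule sz_d_decomposition)
  obtain a b f where abf: "t = sz_sum a b f"
    using t unfolding sz_bivectors_def by blast
  define mm where "mm i j = R (2*i - 1) (2*j - 1)" for i j
  define n where "n i j = R (2*i - 1) (2*j)" for i j
  define p where "p i j = R (2*i) (2*j)" for i j
  note expansion = r[unfolded d_part abf sz_sum_def, folded mm_def n_def p_def]
  have n_swap: "n j i = - R (2*i) (2*j - 1)" for i j
    unfolding n_def by (rule bivector_coeff_anti)
  show ?thesis
  proof (intro conjI impI)
    assume nd: "nondegenerate br"
    have zero: "mm i j = 0" "n i j = 0" "p i j = 0" if "i \<in> {1..m}" "j \<in> {1..m}" "i \<noteq> j" for i j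
      unfolding mm_def n_def p_def
      using block_zero[OF that(1,2)] weights_distinct[OF nd that] by blast+
    have "(\<Sum>i=1..m. \<Sum>j\<in>{i<..m}. mm i j *\<^sub>R wedge (d (2*i - 1)) (d (2*j - 1))) = 0"
      "(\<Sum>i=1..m. \<Sum>j\<in>{i<..m}. p i j *\<^sub>R wedge (d (2*i)) (d (2*j))) = 0"
      by (auto intro!: sum.neutral simp: zero)
    moreover have "(\<Sum>i=1..m. \<Sum>j=1..m. n i j *\<^sub>R wedge (d (2*i - 1)) (d (2*j)))
        = (\<Sum>i=1..m. n i i *\<^sub>R wedge (d (2*i - 1)) (d (2*i)))"
    proof (intro sum.cong refl)
      fix i assume i: "i \<in> {1..m}"
      have "(\<Sum>j=1..m. n i j *\<^sub>R wedge (d (2*i - 1)) (d (2*j)))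
          = (\<Sum>j=1..m. if j = i then n i i *\<^sub>R wedge (d (2*i - 1)) (d (2*i)) else 0)"
        by (intro sum.cong refl) (use zero(2)[OF i] in auto)
      then show "(\<Sum>j=1..m. n i j *\<^sub>R wedge (d (2*i - 1)) (d (2*j)))
          = n i i *\<^sub>R wedge (d (2*i - 1)) (d (2*i))"
        using i by simp
    qed
    ultimately have "r = (\<Sum>i=1..k0. \<Sum>j\<in>{i<..k0}. a i j *\<^sub>R wedge (s i) (s j))
          + (\<Sum>i=1..k0. \<Sum>j=1..l0. b i j *\<^sub>R wedge (s i) (z j))
          + (\<Sum>i=1..l0. \<Sum>j\<in>{i<..l0}. f i j *\<^sub>R wedge (z i) (z j))
          + (\<Sum>i=1..m. n i i *\<^sub>R wedge (d (2*i - 1)) (d (2*i)))"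
      using expansion by simp
    then show "\<exists>(a :: nat \<Rightarrow> nat \<Rightarrow> real) (b :: nat \<Rightarrow> nat \<Rightarrow> real) (f :: nat \<Rightarrow> nat \<Rightarrow> real)
          (n :: nat \<Rightarrow> nat \<Rightarrow> real).
        r = (\<Sum>i=1..k0. \<Sum>j\<in>{i<..k0}. a i j *\<^sub>R wedge (s i) (s j))
          + (\<Sum>i=1..k0. \<Sum>j=1..l0. b i j *\<^sub>R wedge (s i) (z j))
          + (\<Sum>i=1..l0. \<Sum>j\<in>{i<..l0}. f i j *\<^sub>R wedge (z i) (z j))
          + (\<Sum>i=1..m. n i i *\<^sub>R wedge (d (2*i - 1)) (d (2*i)))"
      by blast
  next
    \<comment> \<open>Both signs cannot occur together since the weight \<open>i\<close> is nonzero; where neither does, the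
      default value \<open>1\<close> is harmless because the block vanishes.\<close>
    define \<epsilon> :: "nat \<Rightarrow> nat \<Rightarrow> real" where
      "\<epsilon> i j = (if \<forall>k\<in>{1..k0}. lam k j = - lam k i then -1 else 1)" for i j
    have signs: "\<epsilon> i j \<in> {-1, 1} \<and> p i j = \<epsilon> i j * mm i j \<and> n j i = \<epsilon> i j * n i j \<and>
        (\<forall>e\<in>{-1, 1}. (\<forall>k\<in>{1..k0}. lam k j = e * lam k i) \<longrightarrow> \<epsilon> i j = e)"
      if "1 \<le> i \<and> i < j \<and> j \<le> m" for i j
    proof -
      have i: "i \<in> {1..m}" and j: "j \<in> {1..m}" using that by auto
      have \<epsilon>: "\<epsilon> i j = e" if "e \<in> {-1, 1}" "\<forall>k\<in>{1..k0}. lam k j = e * lam k i" for e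
      proof -
        obtain k where "k \<in> {1..k0}" "lam k i \<noteq> 0" using weight_nonzero[OF i] by blast
        then show ?thesis using that by (auto simp: \<epsilon>_def)
      qed
      have "p i j = \<epsilon> i j * mm i j \<and> n j i = \<epsilon> i j * n i j"
      proof (cases "\<exists>e\<in>{-1, 1}. \<forall>k\<in>{1..k0}. lam k j = e * lam k i")
        case True
        then obtain e where e: "e \<in> {-1, 1}" "\<forall>k\<in>{1..k0}. lam k j = e * lam k i" by blast
        show ?thesis
          using block_sign[OF i j e] n_swap[of j i]
          by (simp add: \<epsilon>[OF e] mm_def n_def p_def)
      next
        case False
        show ?thesis
          using block_zero[OF i j False] n_swap[of j i]
          by (simp add: mm_def n_def p_def)
      qed
      then show ?thesis using \<epsilon> by (auto simp: \<epsilon>_def)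
    qed
    show "\<exists>(a :: nat \<Rightarrow> nat \<Rightarrow> real) (b :: nat \<Rightarrow> nat \<Rightarrow> real) (f :: nat \<Rightarrow> nat \<Rightarrow> real)
          (mm :: nat \<Rightarrow> nat \<Rightarrow> real) (n :: nat \<Rightarrow> nat \<Rightarrow> real) (p :: nat \<Rightarrow> nat \<Rightarrow> real)
          (\<epsilon> :: nat \<Rightarrow> nat \<Rightarrow> real).
        r = (\<Sum>i=1..k0. \<Sum>j\<in>{i<..k0}. a i j *\<^sub>R wedge (s i) (s j))
          + (\<Sum>i=1..k0. \<Sum>j=1..l0. b i j *\<^sub>R wedge (s i) (z j))
          + (\<Sum>i=1..l0. \<Sum>j\<in>{i<..l0}. f i j *\<^sub>R wedge (z i) (z j))
          + (\<Sum>i=1..m. \<Sum>j\<in>{i<..m}. mm i j *\<^sub>R wedge (d (2*i - 1)) (d (2*j - 1)))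
          + (\<Sum>i=1..m. \<Sum>j=1..m. n i j *\<^sub>R wedge (d (2*i - 1)) (d (2*j)))
          + (\<Sum>i=1..m. \<Sum>j\<in>{i<..m}. p i j *\<^sub>R wedge (d (2*i)) (d (2*j)))
        \<and> (\<forall>i j. 1 \<le> i \<and> i < j \<and> j \<le> m \<longrightarrow>
            \<epsilon> i j \<in> {-1, 1} \<and> p i j = \<epsilon> i j * mm i j \<and> n j i = \<epsilon> i j * n i j \<and>
            (\<forall>e\<in>{-1, 1}. (\<forall>k\<in>{1..k0}. lam k j = e * lam k i) \<longrightarrow> \<epsilon> i j = e))"
      by (rule exI[of _ a], rule exI[of _ b], rule exI[of _ f], rule exI[of _ mm], rule exI[of _ n],
          rule exI[of _ p], rule exI[of _ \<epsilon>], rule conjI,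
          rule expansion[unfolded add.assoc[symmetric]], (rule allI)+, rule impI, rule signs)
  qed
qed

end
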